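(* Let $\mathcal{S}$ be a quantum stochastic source consisting of an alphabet of $N$ pure states $\ket{s_1},\dots,\ket{s_N}$ spanning a $d$-dimensional Hilbert space $\mathcal{H}$ and a stochastic process $X$ with mass function $p$. Fix positive integers $m,l$. For each $k\in\{1,\dots,m\}$ let $(\lambda_i^k)_{i=1}^{d^l}$ be the eigenvalues (with multiplicity, in decreasing order) of the $k$-th block ensemble state $\rho^k$, and let $(\ket{\lambda_i^k})_{i=1}^{d^l}$ be a corresponding orthonormal basis of eigenvectors. Let $$\mathfrak{L}=\Big\{(\ell_1,\dots,\ell_{d^l}) : \ell_i\in\mathbb{N}\cup\{0\}\text{ for all } i,\ \ell_1\le\ell_2\le\cdots\le\ell_{d^l},\ \sum_{i=1}^{d^l}2^{-\ell_i}\le 1\Big\}$$ and define $\mathcal{F}_{\mathcal C}:\mathfrak{L}\to[0,\infty)$ by $$\mathcal{F}_{\mathcal C}((\ell_i)_{i=1}^{d^l})=\sum_{k=1}^m\sum_{i=1}^{d^l}\lambda_i^k\,\ell_i .$$ Then: (1) $\mathcal{F}_{\mathcal C}$ attains its minimum on $\mathfrak{L}$ and $$ILC(\mathcal{S},m,l)=\min\{\mathcal{F}_{\mathcal C}((\ell_i)_{i=1}^{d^l}) : (\ell_i)_{i=1}^{d^l}\in\mathfrak{L}\}.$$ (2) The infimum defining $ILC(\mathcal{S},m,l)$ is a minimum: there is a constrained special block code $\mathcal{V}=\{V^k : k\in\{1,\dots,m\}\}$ with $L(\mathcal{V})=\min_{\mathfrak{L}}\mathcal{F}_{\mathcal C}$.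 Explicitly, if $\mathcal{F}_{\mathcal C}$ attains its minimum at $(\ell_i)_{i=1}^{d^l}\in\mathfrak{L}$, then there exists a sequence $(\omega_i)_{i=1}^{d^l}$ of classical bit strings, with $\omega_i$ of length $\ell_i$, forming the image of a classical uniquely decodable code; for such a sequence the qubit strings $(\ket{\omega_i})_{i=1}^{d^l}$ form a jointly orthonormal sequence of length codewords, and the maps $V^k:\mathcal{H}^{\otimes l}\to(\mathbb{C}^2)^{\oplus}$, $$V^k=\sum_{i=1}^{d^l}\ket{\omega_i}\bra{\lambda_i^k},\qquad k=1,\dots,m,$$ form a constrained special block code $\mathcal{V}$ with $L(\mathcal{V})=\min_{\mathfrak{L}}\mathcal{F}_{\mathcal C}$.
   Context: Pure states are unit vectors. $\mathbb{N}=\{1,2,\dots\}$. Quantum stochastic source: a finite list of pure states $\ket{s_1},\dots,\ket{s_N}$ spanning a $d$-dimensional Hilbert space $\mathcal{H}$ together with a stochastic process $X=(X_n)_{n\ge1}$ with values in $\{1,\dots,N\}$; at time $n$ the state $\ket{s_{X_n}}$ is emitted. Its mass function is $p(n_1,\dots,n_q)=\mathbb{P}(X_1=n_1,\dots,X_q=n_q)$. Write $\ket{s_{n_1}\cdots s_{n_q}}=\ket{s_{n_1}}\otimes\cdots\otimes\ket{s_{n_q}}$. $k$-th block ensemble state (block size $l$): the $p(n_1,\dots,n_{(k-1)l})$-weighted average of the conditional ensemble states of the $k$-th block given the first $(k-1)l$ emissions, that is, $$\rho^k=\sum_{n_1,\dots,n_{kl}=1}^N p(n_1,\dots,n_{kl})\ket{s_{n_{(k-1)l+1}}\cdots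 s_{n_{kl}}}\bra{s_{n_{(k-1)l+1}}\cdots s_{n_{kl}}},$$ a density operator on $\mathcal{H}^{\otimes l}$. Fock space: $(\mathbb{C}^2)^{\oplus}=\bigoplus_{k=0}^\infty(\mathbb{C}^2)^{\otimes k}$ with $(\mathbb{C}^2)^{\otimes0}=\mathbb{C}$; its standard basis is the set of qubit strings $\ket{\omega}$, $\omega$ a finite bit string (including the empty string). A length codeword (length state) of length $\ell$ is a unit vector in $(\mathbb{C}^2)^{\otimes\ell}$ for some integer $\ell\ge 0$. Concatenation $\circ$ is defined on standard basis vectors by concatenating bit strings and extended multilinearly. A sequence of unit vectors $(\ket{\psi_i})_{i=1}^D$ in $(\mathbb{C}^2)^{\oplus}$ is jointly orthonormal if for every $M\in\mathbb{N}$ the family $\ket{\psi_{v_1}\circ\cdots\circ\psi_{v_M}}$, indexed by $(v_1,\dots,v_M)\in\{1,\dots,D\}^M$, is orthonormal (distinct index tuples give orthogonal vectors). A classical code with image $(\omega_i)_{i=1}^D$ is uniquely decodable if the extension of $i\mapsto\omega_i$ to finite strings of indices by concatenation is one-to-one. Constrained special block code (for $\mathcal{S},m,l$): a family of isometries $\mathcal{U}=\{U_k\}_{k=1}^m$ from $\mathcal{H}^{\otimes l}$ to $(\mathbb{C}^2)^{\oplus}$ for which there are a single jointly orthonormal sequence of length codewords $(\ket{\psi_i})_{i=1}^{d^l}$ and, for each $k$, an orthonormal basis $(\ket{e_i^k})_{i=1}^{d^l}$ of $\mathcal{H}^{\otimes l}$ with $U_k=\sum_{i=1}^{d^l}\ket{\psi_i}\bra{e_i^k}$.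 ($U_k$ is used on the $k$-th block irrespective of the states emitted in earlier blocks.) Length observable: $\Lambda=\sum_{\ell=0}^\infty\ell\,\Pi_\ell$, with $\Pi_\ell$ the orthogonal projection of $(\mathbb{C}^2)^{\oplus}$ onto $(\mathbb{C}^2)^{\otimes\ell}$. Average codeword length of $\mathcal{U}=\{U_k\}_{k=1}^m$: $$L(\mathcal{U})=\sum_{n_1,\dots,n_{ml}=1}^N p(n_1,\dots,n_{ml})\,\mathrm{Tr}\big(\ket{x_{n_1,\dots,n_{ml}}}\bra{x_{n_1,\dots,n_{ml}}}\Lambda\big),$$ where $x_{n_1,\dots,n_{ml}}=U_1\ket{s_{n_1}\cdots s_{n_l}}\circ U_2\ket{s_{n_{l+1}}\cdots s_{n_{2l}}}\circ\cdots\circ U_m\ket{s_{n_{(m-1)l+1}}\cdots s_{n_{ml}}}$. $ILC(\mathcal{S},m,l)$ is the infimum of $L(\mathcal{U})$ over all constrained special block codes $\mathcal{U}$ for $\mathcal{S},m,l$.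
   Formalization: For d = 1 the minimizer is ℓ_1 = 0 and the code consisting of the empty string is not uniquely decodable, so unique decodability of (ω_i) is claimed and required only for d ≥ 2; for d = 1 the other claims are kept without it. *)

theory Defs
  imports "HOL-Probability.Probability"
begin

section \<open>Hilbert spaces with a distinguished basis\<close>

text \<open>
  A Hilbert space with orthonormal basis indexed by a type is represented by coordinate
  functions on that type.  The source space is \<open>complex ^ 'd\<close>; its \<open>l\<close>-th tensor power has as
  basis the \<open>'d\<close>-lists of length \<open>l\<close>, and the Fock space of \<open>\<complex>\<^sup>2\<close> has as basis all bit strings.
  All these spaces therefore consist of functions on lists.
\<close>

type_synonym 'a vect = "'a \<Rightarrow> complex"
type_synonym fock = "bool list vect"

definition cinner :: "'a vect \<Rightarrow> 'a vect \<Rightarrow> complex" where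
  "cinner f g = (\<Sum>\<^sub>\<infinity>x. cnj (f x) * g x)"

definition ket :: "'a \<Rightarrow> 'a vect" where
  "ket x = (\<lambda>y. if y = x then 1 else 0)"

definition ketbra :: "'a vect \<Rightarrow> 'b vect \<Rightarrow> 'b vect \<Rightarrow> 'a vect" where
  "ketbra a b v = (\<lambda>x. a x * cinner b v)"

definition ell2_space :: "'a vect set" where
  "ell2_space = {f. (\<lambda>x. (cmod (f x))\<^sup>2) summable_on UNIV}"

text \<open>The Fock space: the Hilbert direct sum of all \<open>(\<complex>\<^sup>2)\<^sup>\<otimes>\<^sup>k\<close>, \<open>k \<ge> 0\<close>.\<close>

definition fock_space :: "fock set" where
  "fock_space = ell2_space"

definition tensor_power :: "nat \<Rightarrow> 'a list vect set" where
  "tensor_power n = {f \<in> ell2_space. \<forall>w. length w \<noteq> n \<longrightarrow> f w = 0}"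

definition tensor :: "(complex ^ 'd) list \<Rightarrow> 'd list vect" where
  "tensor vs = (\<lambda>w. if length w = length vs then \<Prod>i<length vs. (vs ! i) $ (w ! i) else 0)"

definition unit_vector :: "'a vect \<Rightarrow> bool" where
  "unit_vector f \<longleftrightarrow> f \<in> ell2_space \<and> cinner f f = 1"

definition orthonormal_family :: "'i set \<Rightarrow> ('i \<Rightarrow> 'a vect) \<Rightarrow> bool" where
  "orthonormal_family I f \<longleftrightarrow>
     (\<forall>i\<in>I. f i \<in> ell2_space) \<and>
     (\<forall>i\<in>I. \<forall>j\<in>I. cinner (f i) (f j) = (if i = j then 1 else 0))"

text \<open>Only used for finite index sets, hence spanning is purely algebraic.\<close>

definition orthonormal_basis :: "'a vect set \<Rightarrow> 'i set \<Rightarrow> ('i \<Rightarrow> 'a vect) \<Rightarrow> bool" where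
  "orthonormal_basis V I f \<longleftrightarrow>
     (\<forall>i\<in>I. f i \<in> V) \<and> orthonormal_family I f \<and>
     (\<forall>v\<in>V. \<exists>c. v = (\<lambda>x. \<Sum>i\<in>I. c i * f i x))"

definition isometry_into :: "'a vect set \<Rightarrow> 'b vect set \<Rightarrow> ('a vect \<Rightarrow> 'b vect) \<Rightarrow> bool" where
  "isometry_into V W U \<longleftrightarrow>
     (\<forall>v\<in>V. U v \<in> W) \<and>
     (\<forall>u\<in>V. \<forall>v\<in>V. \<forall>a b. U (\<lambda>x. a * u x + b * v x) = (\<lambda>y. a * U u y + b * U v y)) \<and>
     (\<forall>u\<in>V. \<forall>v\<in>V. cinner (U u) (U v) = cinner u v)"

section \<open>Quantum stochastic sources\<close>

definition quantum_stochastic_source ::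
  "'w measure \<Rightarrow> (nat \<Rightarrow> 'w \<Rightarrow> nat) \<Rightarrow> nat \<Rightarrow> (nat \<Rightarrow> complex ^ 'd) \<Rightarrow> bool" where
  "quantum_stochastic_source M X N s \<longleftrightarrow>
     prob_space M \<and>
     (\<forall>n\<ge>1. X n \<in> measurable M (count_space {1..N})) \<and>
     (\<forall>i\<in>{1..N}. norm (s i) = 1) \<and>
     vec.span (s ` {1..N}) = UNIV"

text \<open>Processes start at time 1, lists at position 0.\<close>

definition mass_function :: "'w measure \<Rightarrow> (nat \<Rightarrow> 'w \<Rightarrow> nat) \<Rightarrow> nat list \<Rightarrow> real" where
  "mass_function M X ns = measure M {\<omega> \<in> space M. \<forall>i<length ns. X (i + 1) \<omega> = ns ! i}"

definition tuples :: "nat \<Rightarrow> nat \<Rightarrow> nat list set" where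
  "tuples n q = {ns. length ns = q \<and> set ns \<subseteq> {1..n}}"

text \<open>The \<open>k\<close>-th block of length \<open>l\<close>, \<open>k \<ge> 1\<close>: the entries at (1-based) positions \<open>(k-1)l+1, \<dots>, kl\<close>.\<close>

definition block :: "nat \<Rightarrow> nat \<Rightarrow> 'a list \<Rightarrow> 'a list" where
  "block l k ns = take l (drop ((k - 1) * l) ns)"

definition block_vector :: "(nat \<Rightarrow> complex ^ 'd) \<Rightarrow> nat \<Rightarrow> nat \<Rightarrow> nat list \<Rightarrow> 'd list vect" where
  "block_vector s l k ns = tensor (map s (block l k ns))"

definition block_ensemble_state ::
  "(nat list \<Rightarrow> real) \<Rightarrow> nat \<Rightarrow> (nat \<Rightarrow> complex ^ 'd) \<Rightarrow> nat \<Rightarrow> nat \<Rightarrow> 'd list vect \<Rightarrow> 'd list vect" where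
  "block_ensemble_state p N s l k v =
     (\<lambda>w. \<Sum>ns\<in>tuples N (k * l).
        complex_of_real (p ns) * ketbra (block_vector s l k ns) (block_vector s l k ns) v w)"

section \<open>Codes\<close>

text \<open>The bilinear extension of concatenation of bit strings: the sum runs over the finitely many
  ways of splitting \<open>w\<close>.\<close>

definition concat2 :: "fock \<Rightarrow> fock \<Rightarrow> fock" where
  "concat2 f g = (\<lambda>w. \<Sum>(u, v) | u @ v = w. f u * g v)"

definition fock_concat :: "fock list \<Rightarrow> fock" where
  "fock_concat fs = foldr concat2 fs (ket [])"

definition length_codeword :: "fock \<Rightarrow> bool" where
  "length_codeword f \<longleftrightarrow> (\<exists>n. f \<in> tensor_power n \<and> unit_vector f)"

definition jointly_orthonormal :: "nat \<Rightarrow> (nat \<Rightarrow> fock) \<Rightarrow> bool" where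
  "jointly_orthonormal D \<psi> \<longleftrightarrow>
     (\<forall>i\<in>{1..D}. \<psi> i \<in> fock_space \<and> unit_vector (\<psi> i)) \<and>
     (\<forall>M\<ge>1. orthonormal_family (tuples D M) (\<lambda>v. fock_concat (map \<psi> v)))"

text \<open>Index strings of different lengths must be separated as well.  In particular the one-word
  code consisting of the empty string is not uniquely decodable, although its only qubit string is
  jointly orthonormal.\<close>

definition uniquely_decodable :: "nat \<Rightarrow> (nat \<Rightarrow> 'a list) \<Rightarrow> bool" where
  "uniquely_decodable D \<omega> \<longleftrightarrow> inj_on (\<lambda>v. concat (map \<omega> v)) (lists {1..D})"

definition code_map :: "nat \<Rightarrow> (nat \<Rightarrow> fock) \<Rightarrow> (nat \<Rightarrow> 'a vect) \<Rightarrow> 'a vect \<Rightarrow> fock" where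
  "code_map D \<psi> e v = (\<lambda>w. \<Sum>i=1..D. ketbra (\<psi> i) (e i) v w)"

definition constrained_special_block_code ::
  "nat \<Rightarrow> nat \<Rightarrow> (nat \<Rightarrow> 'd::finite list vect \<Rightarrow> fock) \<Rightarrow> bool" where
  "constrained_special_block_code m l U \<longleftrightarrow>
     (\<forall>k\<in>{1..m}. isometry_into (tensor_power l) fock_space (U k)) \<and>
     (\<exists>\<psi> e.
        jointly_orthonormal (CARD('d) ^ l) \<psi> \<and>
        (\<forall>i\<in>{1..CARD('d) ^ l}. length_codeword (\<psi> i)) \<and>
        (\<forall>k\<in>{1..m}.
           orthonormal_basis (tensor_power l) {1..CARD('d) ^ l} (e k) \<and>
           (\<forall>v\<in>tensor_power l. U k v = code_map (CARD('d) ^ l) \<psi> (e k) v)))"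

section \<open>Average codeword length\<close>

definition length_projection :: "nat \<Rightarrow> fock \<Rightarrow> fock" where
  "length_projection n f = (\<lambda>w. if length w = n then f w else 0)"

definition length_observable :: "fock \<Rightarrow> fock" where
  "length_observable f = (\<lambda>w. \<Sum>\<^sub>\<infinity>n. of_nat n * length_projection n f w)"

definition fock_trace :: "(fock \<Rightarrow> fock) \<Rightarrow> complex" where
  "fock_trace A = (\<Sum>\<^sub>\<infinity>w. cinner (ket w) (A (ket w)))"

definition encoded_state ::
  "(nat \<Rightarrow> complex ^ 'd) \<Rightarrow> nat \<Rightarrow> nat \<Rightarrow> (nat \<Rightarrow> 'd list vect \<Rightarrow> fock) \<Rightarrow> nat list \<Rightarrow> fock" where
  "encoded_state s m l U ns = fock_concat (map (\<lambda>k. U k (block_vector s l k ns)) [1..<m + 1])"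

text \<open>The trace is a nonnegative real: it equals \<open>\<Sum>w. |x w|\<^sup>2 * length w\<close>.\<close>

definition average_length ::
  "(nat list \<Rightarrow> real) \<Rightarrow> nat \<Rightarrow> (nat \<Rightarrow> complex ^ 'd) \<Rightarrow> nat \<Rightarrow> nat \<Rightarrow>
     (nat \<Rightarrow> 'd list vect \<Rightarrow> fock) \<Rightarrow> real" where
  "average_length p N s m l U =
     (\<Sum>ns\<in>tuples N (m * l). p ns *
        Re (fock_trace (ketbra (encoded_state s m l U ns) (encoded_state s m l U ns) \<circ> length_observable)))"

definition ILC :: "(nat list \<Rightarrow> real) \<Rightarrow> nat \<Rightarrow> (nat \<Rightarrow> complex ^ 'd::finite) \<Rightarrow> nat \<Rightarrow> nat \<Rightarrow> real" where
  "ILC p N s m l = Inf {average_length p N s m l U | U. constrained_special_block_code m l U}"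

section \<open>The classical minimization problem\<close>

definition length_sequences :: "nat \<Rightarrow> (nat \<Rightarrow> nat) set" where
  "length_sequences D = {len. mono_on {1..D} len \<and> (\<Sum>i=1..D. 1 / 2 ^ len i) \<le> (1::real)}"

definition length_functional ::
  "(nat \<Rightarrow> nat \<Rightarrow> real) \<Rightarrow> nat \<Rightarrow> nat \<Rightarrow> (nat \<Rightarrow> nat) \<Rightarrow> real" where
  "length_functional lam m D len = (\<Sum>k=1..m. \<Sum>i=1..D. lam k i * real (len i))"

end

(* Since the code words of a constrained special block code are jointly orthonormal and have definite
   lengths, the length of an encoded message is distributed like a sum of independent classical
   lengths: block k has length len i with probability |<e i, v>|^2, where v is the emitted block.
   Averaging over the source turns these probabilities into the expectations <e i, rho e i> of the
   block ensemble state, which are doubly stochastic averages of its eigenvalues. Hence pairing the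
   decreasing eigenvalues with the increasing lengths is optimal, and eigenbases attain this
   pairing. The admissible lengths are those of the Kraft inequality: the McMillan argument carries
   over to jointly orthonormal length codewords, with Bessel's inequality instead of counting, and
   conversely the Kraft inequality yields a classical prefix-free code. *)
theory Submission
  imports Defs
begin

text \<open>The codewords are shared by all blocks, so one permutation sorts their lengths for every
  k at once. The eigenbases may still vary with k, hence the rearrangement bound holds block by
  block and the bounds add up. Correlations between blocks do no harm: expected lengths add, so only
  the marginal of each block enters. In the Kraft bound a codeword may be a superposition of bit
  strings, so distinct codewords can share coordinates; orthonormality still limits the total
  squared weight at each coordinate to 1, which replaces the count of words. The case d = 1 is
  exceptional: the optimal length is 0, and the empty string alone is not uniquely decodable,
  although it gives a jointly orthonormal sequence, because joint orthonormality compares only index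
  tuples of equal length. Hence the guard \<open>CARD('d) >= 2\<close> in front of unique
  decodability.\<close>

section \<open>Finitely supported vectors\<close>

text \<open>Source blocks, length codewords and their concatenations are all supported on finitely
  many words, so their inner products become finite sums and need no summability argument.\<close>

definition finsupp :: "'a vect \<Rightarrow> bool" where
  "finsupp f \<longleftrightarrow> finite {x. f x \<noteq> 0}"

lemma finsuppI: "finite S \<Longrightarrow> (\<And>x. x \<notin> S \<Longrightarrow> f x = 0) \<Longrightarrow> finsupp f"
  unfolding finsupp_def by (rule finite_subset[of _ S]) auto

lemma finsupp_ket [simp]: "finsupp (ket x)"
  by (rule finsuppI[of "{x}"]) (auto simp: ket_def)

lemma finsupp_sum:
  assumes "finite I" "\<And>i. i \<in> I \<Longrightarrow> finsupp (g i)"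
  shows "finsupp (\<lambda>x. \<Sum>i\<in>I. c i * g i x)"
proof (rule finsuppI)
  show "finite (\<Union>i\<in>I. {x. g i x \<noteq> 0})"
    using assms unfolding finsupp_def by blast
qed (auto intro!: sum.neutral)

lemma cinner_eq_sum:
  assumes "finite S" "\<And>x. x \<notin> S \<Longrightarrow> f x = 0 \<or> g x = 0"
  shows "cinner f g = (\<Sum>x\<in>S. cnj (f x) * g x)"
proof -
  have "cinner f g = infsum (\<lambda>x. cnj (f x) * g x) S"
    unfolding cinner_def by (rule infsum_cong_neutral) (use assms in auto)
  then show ?thesis
    using assms(1) by simp
qed

lemma cinner_ket: "cinner (ket x) f = f x"
  by (subst cinner_eq_sum[of "{x}"]) (auto simp: ket_def)

lemma cinner_ket_right: "cinner f (ket x) = cnj (f x)"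
  by (subst cinner_eq_sum[of "{x}"]) (auto simp: ket_def)

lemma finsupp_ell2: "finsupp f \<Longrightarrow> f \<in> ell2_space"
proof -
  assume "finsupp f"
  then have "(\<lambda>x. (cmod (f x))\<^sup>2) summable_on {x. f x \<noteq> 0}"
    unfolding finsupp_def by (rule summable_on_finite)
  then have "(\<lambda>x. (cmod (f x))\<^sup>2) summable_on UNIV"
    by (subst (asm) summable_on_cong_neutral[of UNIV _ _ "\<lambda>x. (cmod (f x))\<^sup>2"]) auto
  then show "f \<in> ell2_space"
    by (simp add: ell2_space_def)
qed

lemma cinner_commute: "finsupp f \<Longrightarrow> cinner g f = cnj (cinner f g)"
proof -
  assume f: "finsupp f"
  have "cinner g f = (\<Sum>x | f x \<noteq> 0. cnj (g x) * f x)"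
    by (rule cinner_eq_sum) (use f in \<open>auto simp: finsupp_def\<close>)
  moreover have "cinner f g = (\<Sum>x | f x \<noteq> 0. cnj (f x) * g x)"
    by (rule cinner_eq_sum) (use f in \<open>auto simp: finsupp_def\<close>)
  ultimately show ?thesis
    by (simp add: mult.commute)
qed

lemma cinner_sum_right:
  assumes "finsupp f"
  shows "cinner f (\<lambda>x. \<Sum>i\<in>I. c i * g i x) = (\<Sum>i\<in>I. c i * cinner f (g i))"
proof -
  let ?S = "{x. f x \<noteq> 0}"
  have S: "finite ?S" using assms by (simp add: finsupp_def)
  have *: "cinner f h = (\<Sum>x\<in>?S. cnj (f x) * h x)" for h
    by (rule cinner_eq_sum[OF S]) auto
  show ?thesis
    unfolding * sum_distrib_left by (subst sum.swap) (simp add: mult_ac)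
qed

lemma cinner_sum_left:
  assumes "finsupp f"
  shows "cinner (\<lambda>x. \<Sum>i\<in>I. c i * g i x) f = (\<Sum>i\<in>I. cnj (c i) * cinner (g i) f)"
proof -
  let ?S = "{x. f x \<noteq> 0}"
  have S: "finite ?S" using assms by (simp add: finsupp_def)
  have *: "cinner h f = (\<Sum>x\<in>?S. cnj (h x) * f x)" for h
    by (rule cinner_eq_sum[OF S]) auto
  show ?thesis
    unfolding * cnj_sum sum_distrib_left sum_distrib_right complex_cnj_mult
    by (subst sum.swap) (simp add: mult_ac)
qed

lemma cinner_self:
  assumes "finsupp f"
  shows "cinner f f = of_real (\<Sum>x | f x \<noteq> 0. (cmod (f x))\<^sup>2)"
  using assms unfolding finsupp_def
  by (subst cinner_eq_sum[of "{x. f x \<noteq> 0}"])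
     (auto simp: complex_norm_square mult.commute simp del: of_real_power)

lemma cmod_square_le_cinner_self:
  assumes "finsupp f"
  shows "(cmod (f x))\<^sup>2 \<le> Re (cinner f f)"
proof (cases "f x = 0")
  case False
  then show ?thesis
    using assms unfolding cinner_self[OF assms] finsupp_def
    by (auto intro: member_le_sum)
next
  case True
  then show ?thesis
    unfolding cinner_self[OF assms] by (auto intro: sum_nonneg)
qed

lemma cinner_orthonormal:
  assumes on: "orthonormal_family I f" and I: "finite I" and fs: "\<And>i. i \<in> I \<Longrightarrow> finsupp (f i)"
  shows "cinner (\<lambda>x. \<Sum>i\<in>I. a i * f i x) (\<lambda>x. \<Sum>i\<in>I. b i * f i x) = (\<Sum>i\<in>I. cnj (a i) * b i)"
proof -
  have "cinner (\<lambda>x. \<Sum>i\<in>I. a i * f i x) (\<lambda>x. \<Sum>i\<in>I. b i * f i x)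
      = (\<Sum>i\<in>I. cnj (a i) * cinner (f i) (\<lambda>x. \<Sum>j\<in>I. b j * f j x))"
    by (rule cinner_sum_left) (use I fs in \<open>auto intro: finsupp_sum\<close>)
  also have "\<dots> = (\<Sum>i\<in>I. cnj (a i) * (\<Sum>j\<in>I. b j * cinner (f i) (f j)))"
    using fs by (intro sum.cong) (auto simp: cinner_sum_right)
  also have "\<dots> = (\<Sum>i\<in>I. cnj (a i) * (\<Sum>j\<in>I. if i = j then b i else 0))"
    using on unfolding orthonormal_family_def
    by (intro sum.cong arg_cong2[where f = "(*)"]) auto
  also have "\<dots> = (\<Sum>i\<in>I. cnj (a i) * b i)"
    using I by simp
  finally show ?thesis .
qed

text \<open>The vector \<open>\<Sum>i. cnj (f i x) * f i\<close> is the projection of \<open>ket x\<close> onto the span of the family.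
  Its norm squared and its value at \<open>x\<close> both equal the sum in question.\<close>

lemma bessel_coordinate:
  assumes on: "orthonormal_family I f" and I: "finite I" and fs: "\<And>i. i \<in> I \<Longrightarrow> finsupp (f i)"
  shows "(\<Sum>i\<in>I. (cmod (f i x))\<^sup>2) \<le> 1"
proof -
  define B where "B = (\<Sum>i\<in>I. (cmod (f i x))\<^sup>2)"
  define g where "g = (\<lambda>y. \<Sum>i\<in>I. cnj (f i x) * f i y)"
  have g: "finsupp g" unfolding g_def by (rule finsupp_sum[OF I fs])
  have gx: "g x = of_real B"
    unfolding g_def B_def by (simp add: complex_norm_square mult.commute del: of_real_power)
  have "cinner g g = (\<Sum>i\<in>I. cnj (cnj (f i x)) * cnj (f i x))"
    unfolding g_def by (rule cinner_orthonormal[OF on I fs])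
  then have gg: "cinner g g = of_real B"
    by (simp add: B_def complex_norm_square del: of_real_power)
  have "B\<^sup>2 \<le> B"
    using cmod_square_le_cinner_self[OF g, of x] by (simp add: gx gg)
  moreover have "B \<ge> 0" by (simp add: B_def sum_nonneg)
  ultimately have "B \<le> 1"
    using mult_strict_right_mono[of 1 B B] by (cases "B \<le> 1") (auto simp: power2_eq_square)
  then show ?thesis by (simp add: B_def)
qed

section \<open>Tensor powers\<close>

lemma finite_length_eq: "finite {w :: 'a :: finite list. length w = n}"
  using finite_lists_length_eq[of "UNIV :: 'a set" n] by simp

text \<open>Over a finite alphabet there are finitely many words of length \<open>n\<close>, so
  square summability is automatic.\<close>

lemma tensor_power_iff:
  fixes f :: "'a :: finite list vect"
  shows "f \<in> tensor_power n \<longleftrightarrow> (\<forall>w. length w \<noteq> n \<longrightarrow> f w = 0)"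
proof -
  have "f \<in> ell2_space" if "\<forall>w. length w \<noteq> n \<longrightarrow> f w = 0"
    by (rule finsupp_ell2, rule finsuppI[OF finite_length_eq[of n]]) (use that in auto)
  then show ?thesis by (auto simp: tensor_power_def)
qed

lemma finsupp_tensor_power:
  fixes f :: "'a :: finite list vect"
  shows "f \<in> tensor_power n \<Longrightarrow> finsupp f"
  by (rule finsuppI[OF finite_length_eq[of n]]) (auto simp: tensor_power_iff)

lemma tensor_in_tensor_power:
  fixes vs :: "(complex ^ 'd :: finite) list"
  shows "tensor vs \<in> tensor_power (length vs)"
  by (auto simp: tensor_power_iff tensor_def)

lemma sum_length_Suc:
  "(\<Sum>w | length w = Suc n. f w) = (\<Sum>a\<in>(UNIV :: 'a :: finite set). \<Sum>w | length w = n. f (a # w))"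
proof -
  have "(\<Sum>w | length w = Suc n. f w) = sum f ((\<lambda>(a, w). a # w) ` (UNIV \<times> {w :: 'a list. length w = n}))"
    by (rule arg_cong[where f = "sum f"]) (auto simp: length_Suc_conv image_iff)
  also have "\<dots> = (\<Sum>a\<in>UNIV. \<Sum>w | length w = n. f (a # w))"
    by (subst sum.reindex) (auto simp: inj_on_def sum.cartesian_product case_prod_unfold)
  finally show ?thesis .
qed

text \<open>The squared moduli of the coordinates form a product distribution on words; summing out
  the first letter gives a factor 1 and leaves the shorter tensor.\<close>

lemma cinner_tensor_self:
  fixes vs :: "(complex ^ 'd :: finite) list"
  assumes "\<And>v. v \<in> set vs \<Longrightarrow> norm v = 1"
  shows "cinner (tensor vs) (tensor vs) = 1"
proof -
  have "(\<Sum>w | length w = length vs. \<Prod>i<length vs. (cmod ((vs ! i) $ (w ! i)))\<^sup>2) = 1"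
    using assms
  proof (induction vs)
    case Nil
    then show ?case by simp
  next
    case (Cons v vs)
    have "(\<Sum>a\<in>UNIV. (cmod (v $ a))\<^sup>2) = (norm v)\<^sup>2"
      by (simp add: norm_vec_def L2_set_def sum_nonneg)
    then have v: "(\<Sum>a\<in>UNIV. (cmod (v $ a))\<^sup>2) = 1"
      using Cons.prems by simp
    have "(\<Sum>w | length w = length (v # vs). \<Prod>i<length (v # vs). (cmod (((v # vs) ! i) $ (w ! i)))\<^sup>2)
        = (\<Sum>a\<in>UNIV. \<Sum>w | length w = length vs.
             (cmod (v $ a))\<^sup>2 * (\<Prod>i<length vs. (cmod ((vs ! i) $ (w ! i)))\<^sup>2))"
      by (simp add: sum_length_Suc prod.lessThan_Suc_shift del: prod.lessThan_Suc)
    also have "\<dots> = (\<Sum>a\<in>UNIV. (cmod (v $ a))\<^sup>2)"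
      using Cons by (simp flip: sum_distrib_left)
    finally show ?case using v by simp
  qed
  moreover have "cinner (tensor vs) (tensor vs)
      = (\<Sum>w | length w = length vs. of_real ((cmod (tensor vs w))\<^sup>2))"
    by (subst cinner_eq_sum[OF finite_length_eq[of "length vs"]])
       (auto simp: tensor_def complex_norm_square mult.commute simp del: of_real_power)
  moreover have "(\<Sum>w | length w = length vs. (cmod (tensor vs w))\<^sup>2)
      = (\<Sum>w | length w = length vs. \<Prod>i<length vs. (cmod ((vs ! i) $ (w ! i)))\<^sup>2)"
    by (rule sum.cong) (auto simp: tensor_def prod_power_distrib simp flip: prod_norm)
  ultimately show ?thesis
    by (simp flip: of_real_sum del: of_real_power)
qed

text \<open>Spanning provides some coefficients, and orthonormality forces them to be these inner
  products.\<close>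

lemma basis_expand:
  fixes v :: "'a :: finite list vect"
  assumes e: "orthonormal_basis (tensor_power n) I e" and I: "finite I" and v: "v \<in> tensor_power n"
  shows "v = (\<lambda>x. \<Sum>i\<in>I. cinner (e i) v * e i x)"
proof -
  obtain c where c: "v = (\<lambda>x. \<Sum>i\<in>I. c i * e i x)"
    using e v unfolding orthonormal_basis_def by blast
  have fs: "finsupp (e i)" if "i \<in> I" for i
    using e that unfolding orthonormal_basis_def by (auto intro: finsupp_tensor_power)
  have "cinner (e i) v = c i" if "i \<in> I" for i
  proof -
    have "cinner (e i) v = (\<Sum>j\<in>I. c j * cinner (e i) (e j))"
      unfolding c using fs that by (subst cinner_sum_right) auto
    also have "\<dots> = (\<Sum>j\<in>I. if i = j then c i else 0)"
      using e that unfolding orthonormal_basis_def orthonormal_family_def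
      by (intro sum.cong) auto
    finally show ?thesis using I that by simp
  qed
  then show ?thesis unfolding c by (auto intro!: sum.cong)
qed

lemma parseval:
  fixes u v :: "'a :: finite list vect"
  assumes e: "orthonormal_basis (tensor_power n) I e" and I: "finite I"
    and u: "u \<in> tensor_power n" and v: "v \<in> tensor_power n"
  shows "cinner u v = (\<Sum>i\<in>I. cnj (cinner (e i) u) * cinner (e i) v)"
proof -
  have fs: "finsupp (e i)" if "i \<in> I" for i
    using e that unfolding orthonormal_basis_def by (auto intro: finsupp_tensor_power)
  have "cinner u v = cinner (\<lambda>x. \<Sum>i\<in>I. cinner (e i) u * e i x) (\<lambda>x. \<Sum>i\<in>I. cinner (e i) v * e i x)"
    using basis_expand[OF e I u] basis_expand[OF e I v] by simp
  also have "\<dots> = (\<Sum>i\<in>I. cnj (cinner (e i) u) * cinner (e i) v)"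
    by (rule cinner_orthonormal) (use e I fs in \<open>auto simp: orthonormal_basis_def\<close>)
  finally show ?thesis .
qed

text \<open>Makes the squared moduli a probability distribution: of the codeword used for a block,
  and later of the rows and columns of a doubly stochastic matrix.\<close>

lemma parseval_norm:
  fixes v :: "'a :: finite list vect"
  assumes "orthonormal_basis (tensor_power n) I e" "finite I" "v \<in> tensor_power n" "cinner v v = 1"
  shows "(\<Sum>i\<in>I. (cmod (cinner (e i) v))\<^sup>2) = 1"
proof -
  have "complex_of_real (\<Sum>i\<in>I. (cmod (cinner (e i) v))\<^sup>2) = cinner v v"
    using parseval[OF assms(1-3,3)]
    by (simp add: complex_norm_square mult.commute del: of_real_power)
  then show ?thesis using assms(4) by (simp only: of_real_eq_1_iff)
qed

section \<open>Index tuples and concatenation\<close>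

lemma tuples_0 [simp]: "tuples n 0 = {[]}"
  by (auto simp: tuples_def)

lemma tuples_Suc: "tuples n (Suc q) = (\<lambda>(a, v). a # v) ` ({1..n} \<times> tuples n q)"
  by (auto simp: tuples_def length_Suc_conv image_iff)

lemma finite_tuples [simp]: "finite (tuples n q)"
  by (induction q) (auto simp: tuples_Suc)

lemma sum_tuples_Suc: "(\<Sum>v\<in>tuples n (Suc q). f v) = (\<Sum>a=1..n. \<Sum>v\<in>tuples n q. f (a # v))"
  unfolding tuples_Suc
  by (subst sum.reindex) (auto simp: inj_on_def sum.cartesian_product case_prod_unfold)

lemma sum_tuples_add:
  "(\<Sum>v\<in>tuples n (q + r). f v) = (\<Sum>u\<in>tuples n q. \<Sum>v\<in>tuples n r. f (u @ v))"
  by (induction q arbitrary: f) (simp_all add: sum_tuples_Suc)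

lemma tuples_D: "v \<in> tuples n q \<Longrightarrow> length v = q \<and> set v \<subseteq> {1..n}"
  by (simp add: tuples_def)

text \<open>\<open>concat2\<close> sums over this set; a sum over an infinite set would be 0 by
  default.\<close>

lemma finite_splits: "finite {(u, v). u @ v = w}"
proof (rule finite_subset)
  show "{(u, v). u @ v = w} \<subseteq> (\<lambda>i. (take i w, drop i w)) ` {..length w}"
  proof
    fix x assume "x \<in> {(u, v). u @ v = w}"
    then obtain u v where x: "x = (u, v)" and "w = u @ v" by auto
    then have "(u, v) = (take (length u) w, drop (length u) w)" "length u \<in> {..length w}"
      by auto
    then show "x \<in> (\<lambda>i. (take i w, drop i w)) ` {..length w}"
      unfolding x by (rule image_eqI)
  qed
qed simp

lemma concat2_sum:
  assumes "finite I" "finite J"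
  shows "concat2 (\<lambda>w. \<Sum>i\<in>I. a i * f i w) (\<lambda>w. \<Sum>j\<in>J. b j * g j w)
    = (\<lambda>w. \<Sum>i\<in>I. \<Sum>j\<in>J. (a i * b j) * concat2 (f i) (g j) w)"
proof
  fix w
  have "concat2 (\<lambda>w. \<Sum>i\<in>I. a i * f i w) (\<lambda>w. \<Sum>j\<in>J. b j * g j w) w
    = (\<Sum>(u, v) | u @ v = w. \<Sum>i\<in>I. \<Sum>j\<in>J. (a i * b j) * (f i u * g j v))"
    unfolding concat2_def by (intro sum.cong) (auto simp: sum_product mult_ac)
  also have "\<dots> = (\<Sum>i\<in>I. \<Sum>j\<in>J. \<Sum>(u, v) | u @ v = w. (a i * b j) * (f i u * g j v))"
    unfolding case_prod_unfold by (subst sum.swap, subst sum.swap) simp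
  also have "\<dots> = (\<Sum>i\<in>I. \<Sum>j\<in>J. (a i * b j) * concat2 (f i) (g j) w)"
    unfolding concat2_def sum_distrib_left case_prod_unfold ..
  finally show "concat2 (\<lambda>w. \<Sum>i\<in>I. a i * f i w) (\<lambda>w. \<Sum>j\<in>J. b j * g j w) w
    = (\<Sum>i\<in>I. \<Sum>j\<in>J. (a i * b j) * concat2 (f i) (g j) w)" .
qed

lemma concat2_ket: "concat2 (ket u) (ket v) = ket (u @ v)"
proof
  fix w
  have "concat2 (ket u) (ket v) w = (\<Sum>x | fst x @ snd x = w. if x = (u, v) then 1 else 0)"
    unfolding concat2_def case_prod_unfold by (rule sum.cong) (auto simp: ket_def prod_eq_iff)
  then show "concat2 (ket u) (ket v) w = ket (u @ v) w"
    using finite_splits[of w] by (simp add: ket_def case_prod_unfold eq_commute)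
qed

lemma fock_concat_Nil [simp]: "fock_concat [] = ket []"
  and fock_concat_Cons [simp]: "fock_concat (f # fs) = concat2 f (fock_concat fs)"
  by (simp_all add: fock_concat_def)

lemma fock_concat_ket: "fock_concat (map (\<lambda>i. ket (\<omega> i)) v) = ket (concat (map \<omega> v))"
  by (induction v) (simp_all add: concat2_ket)

lemma ket_in_tensor_power: "ket w \<in> tensor_power (length w)"
  by (simp add: tensor_power_def finsupp_ell2) (simp add: ket_def)

lemma concat2_tensor_power:
  assumes "f \<in> tensor_power a" "g \<in> tensor_power b"
  shows "concat2 f g \<in> tensor_power (a + b)"
proof -
  have "(\<Sum>x | fst x @ snd x = w. f (fst x) * g (snd x)) = 0" if "length w \<noteq> a + b" for w
  proof (intro sum.neutral ballI)
    fix x assume "x \<in> {x. fst x @ snd x = w}"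
    then have "length (fst x) \<noteq> a \<or> length (snd x) \<noteq> b"
      using that by auto
    then show "f (fst x) * g (snd x) = 0"
      using assms by (auto simp: tensor_power_iff)
  qed
  then show ?thesis
    by (simp add: tensor_power_iff concat2_def case_prod_unfold)
qed

lemma fock_concat_tensor_power:
  assumes "\<And>i. i \<in> set v \<Longrightarrow> \<psi> i \<in> tensor_power (len i)"
  shows "fock_concat (map \<psi> v) \<in> tensor_power (sum_list (map len v))"
  using assms
proof (induction v)
  case Nil
  then show ?case using ket_in_tensor_power[of "[]"] by simp
next
  case (Cons i v)
  then show ?case by (auto intro: concat2_tensor_power)
qed

text \<open>Polymorphic because it serves twice: for the complex amplitude of an index tuple and,
  with squared moduli as factors, for its real probability.\<close>

definition coeff_prod :: "(nat \<Rightarrow> 'a :: comm_monoid_mult) list \<Rightarrow> nat list \<Rightarrow> 'a" where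
  "coeff_prod cs v = prod_list (map2 (\<lambda>c i. c i) cs v)"

lemma coeff_prod_simps [simp]:
  "coeff_prod [] v = 1"
  "coeff_prod (c # cs) (i # v) = c i * coeff_prod cs v"
  by (simp_all add: coeff_prod_def)

text \<open>Multilinearity writes an encoded message as one superposition of the vectors that
  \<open>jointly_orthonormal\<close> declares orthonormal.\<close>

lemma fock_concat_expand:
  "fock_concat (map (\<lambda>c w. \<Sum>i=1..D. c i * \<psi> i w) cs)
    = (\<lambda>w. \<Sum>v\<in>tuples D (length cs). coeff_prod cs v * fock_concat (map \<psi> v) w)"
proof (induction cs)
  case Nil
  then show ?case by simp
next
  case (Cons c cs)
  then show ?case
    by (simp add: concat2_sum sum_tuples_Suc)
qed

lemma coeff_prod_cmod:
  "length v = length cs \<Longrightarrow>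
    cnj (coeff_prod cs v) * coeff_prod cs v
      = of_real (coeff_prod (map (\<lambda>c i. (cmod (c i))\<^sup>2) cs) v)"
  by (induction v cs rule: list_induct2)
     (simp_all add: complex_norm_square mult_ac del: of_real_power)

lemma sum_coeff_prod:
  fixes cs :: "(nat \<Rightarrow> real) list"
  assumes "\<And>c. c \<in> set cs \<Longrightarrow> (\<Sum>i=1..D. c i) = 1"
  shows "(\<Sum>v\<in>tuples D (length cs). coeff_prod cs v) = 1"
  using assms
proof (induction cs)
  case (Cons c cs)
  then show ?case by (simp add: sum_tuples_Suc flip: sum_distrib_left)
qed simp

text \<open>Additivity of the mean under a product distribution: the first factor contributes its
  own mean times the total mass 1 of the rest, and conversely.\<close>

lemma sum_coeff_prod_length:
  fixes cs :: "(nat \<Rightarrow> real) list" and len :: "nat \<Rightarrow> nat"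
  assumes "\<And>c. c \<in> set cs \<Longrightarrow> (\<Sum>i=1..D. c i) = 1"
  shows "(\<Sum>v\<in>tuples D (length cs). coeff_prod cs v * real (sum_list (map len v)))
    = (\<Sum>c\<leftarrow>cs. \<Sum>i=1..D. c i * real (len i))"
  using assms
proof (induction cs)
  case (Cons c cs)
  have "(\<Sum>v\<in>tuples D (length (c # cs)). coeff_prod (c # cs) v * real (sum_list (map len v)))
     = (\<Sum>i=1..D. (c i * real (len i)) * (\<Sum>v\<in>tuples D (length cs). coeff_prod cs v)
          + c i * (\<Sum>v\<in>tuples D (length cs). coeff_prod cs v * real (sum_list (map len v))))"
    by (simp add: sum_tuples_Suc sum_distrib_left sum.distrib algebra_simps)
  also have "\<dots> = (\<Sum>c\<leftarrow>c # cs. \<Sum>i=1..D. c i * real (len i))"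
    using Cons by (simp add: sum_coeff_prod sum.distrib flip: sum_distrib_right)
  finally show ?case .
qed simp

section \<open>The length observable\<close>

lemma length_observable_apply: "length_observable f w = of_nat (length w) * f w"
proof -
  have "length_observable f w = infsum (\<lambda>n. of_nat n * length_projection n f w) {length w}"
    unfolding length_observable_def
    by (rule infsum_cong_neutral) (auto simp: length_projection_def)
  then show ?thesis by (simp add: length_projection_def)
qed

lemma fock_trace_length:
  assumes "finsupp x"
  shows "fock_trace (ketbra x x \<circ> length_observable) = cinner x (\<lambda>w. of_nat (length w) * x w)"
proof -
  \<comment> \<open>A one-term sum over \<open>{w}\<close>, so that \<open>cinner_sum_right\<close>
    applies.\<close>
  have "length_observable (ket w) = (\<lambda>v. \<Sum>i\<in>{w}. of_nat (length w) * ket i v)" for w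
    by (auto simp: length_observable_apply ket_def fun_eq_iff)
  then have "cinner x (length_observable (ket w)) = of_nat (length w) * cnj (x w)" for w
    using assms by (simp only: cinner_sum_right) (simp add: cinner_ket_right)
  then have "fock_trace (ketbra x x \<circ> length_observable)
      = (\<Sum>\<^sub>\<infinity>w. x w * (of_nat (length w) * cnj (x w)))"
    by (simp add: fock_trace_def cinner_ket ketbra_def)
  then show ?thesis
    by (simp add: cinner_def mult_ac)
qed

lemma expected_length:
  assumes on: "orthonormal_family (tuples D (length cs)) (\<lambda>v. fock_concat (map \<psi> v))"
    and len: "\<And>i. i \<in> {1..D} \<Longrightarrow> \<psi> i \<in> tensor_power (len i)"
    and one: "\<And>c. c \<in> set cs \<Longrightarrow> (\<Sum>i=1..D. (cmod (c i))\<^sup>2) = 1"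
    and x: "x = fock_concat (map (\<lambda>c w. \<Sum>i=1..D. c i * \<psi> i w) cs)"
  shows "fock_trace (ketbra x x \<circ> length_observable)
    = of_real (\<Sum>c\<leftarrow>cs. \<Sum>i=1..D. (cmod (c i))\<^sup>2 * real (len i))"
proof -
  let ?T = "tuples D (length cs)"
  let ?\<Psi> = "\<lambda>v. fock_concat (map \<psi> v)" and ?L = "\<lambda>v. sum_list (map len v)"
  have \<Psi>: "?\<Psi> v \<in> tensor_power (?L v)" if "v \<in> ?T" for v
    using that len by (intro fock_concat_tensor_power) (auto dest!: tuples_D)
  have fs: "finsupp (?\<Psi> v)" if "v \<in> ?T" for v
    using \<Psi>[OF that] by (rule finsupp_tensor_power)
  have xe: "x = (\<lambda>w. \<Sum>v\<in>?T. coeff_prod cs v * ?\<Psi> v w)"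
    unfolding x by (rule fock_concat_expand)
  \<comment> \<open>Each \<open>?\<Psi> v\<close> vanishes off the words of length
    \<open>?L v\<close>, so it is an eigenvector of the length observable.\<close>
  have "(\<lambda>w. of_nat (length w) * x w) = (\<lambda>w. \<Sum>v\<in>?T. (coeff_prod cs v * of_nat (?L v)) * ?\<Psi> v w)"
  proof
    fix w
    have "of_nat (length w) * (coeff_prod cs v * ?\<Psi> v w)
        = (coeff_prod cs v * of_nat (?L v)) * ?\<Psi> v w" if "v \<in> ?T" for v
      using \<Psi>[OF that] by (cases "length w = ?L v") (auto simp: tensor_power_iff)
    then show "of_nat (length w) * x w = (\<Sum>v\<in>?T. (coeff_prod cs v * of_nat (?L v)) * ?\<Psi> v w)"
      unfolding xe sum_distrib_left by (intro sum.cong) auto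
  qed
  moreover have "finsupp x"
    unfolding xe using fs by (intro finsupp_sum) auto
  ultimately have "fock_trace (ketbra x x \<circ> length_observable)
      = cinner (\<lambda>w. \<Sum>v\<in>?T. coeff_prod cs v * ?\<Psi> v w)
          (\<lambda>w. \<Sum>v\<in>?T. (coeff_prod cs v * of_nat (?L v)) * ?\<Psi> v w)"
    by (simp only: fock_trace_length) (simp only: xe)
  \<comment> \<open>Joint orthonormality removes the cross terms, so amplitudes survive only as
    probabilities.\<close>
  also have "\<dots> = (\<Sum>v\<in>?T. cnj (coeff_prod cs v) * (coeff_prod cs v * of_nat (?L v)))"
    by (rule cinner_orthonormal[OF on]) (use fs in auto)
  also have "\<dots> = of_real (\<Sum>v\<in>?T. coeff_prod (map (\<lambda>c i. (cmod (c i))\<^sup>2) cs) v * real (?L v))"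
    by (simp add: coeff_prod_cmod tuples_D flip: mult.assoc)
  also have "\<dots> = of_real (\<Sum>c\<leftarrow>cs. \<Sum>i=1..D. (cmod (c i))\<^sup>2 * real (len i))"
  proof -
    have "(\<Sum>i=1..D. c i) = 1" if "c \<in> set (map (\<lambda>c i. (cmod (c i))\<^sup>2) cs)" for c
      using that one by auto
    note sum_coeff_prod_length[OF this, of "map (\<lambda>c i. (cmod (c i))\<^sup>2) cs" len]
    then have "(\<Sum>v\<in>?T. coeff_prod (map (\<lambda>c i. (cmod (c i))\<^sup>2) cs) v * real (?L v))
        = (\<Sum>c\<leftarrow>cs. \<Sum>i=1..D. (cmod (c i))\<^sup>2 * real (len i))"
      by (simp add: comp_def)
    then show ?thesis by simp
  qed
  finally show ?thesis .
qed

section \<open>The Kraft inequality\<close>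

lemma sum_pow_half_length: "(\<Sum>w | length w = n. 1 / 2 ^ length (w :: bool list)) = (1 :: real)"
proof -
  have "card {w :: bool list. length w = n} = 2 ^ n"
    using card_lists_length_eq[of "UNIV :: bool set" n] by (simp add: card_UNIV_bool)
  moreover have "(\<Sum>w | length w = n. 1 / 2 ^ length (w :: bool list)) = (\<Sum>w | length (w :: bool list) = n. 1 / 2 ^ n :: real)"
    by (rule sum.cong) auto
  ultimately show ?thesis by simp
qed

text \<open>The Kraft sum is multiplicative under concatenation, which lets a weak bound on long
  concatenations be sharpened by taking roots.\<close>

lemma sum_tuples_power:
  fixes len :: "nat \<Rightarrow> nat"
  shows "(\<Sum>v\<in>tuples D M. 1 / 2 ^ sum_list (map len v)) = (\<Sum>i=1..D. 1 / 2 ^ len i :: real) ^ M"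
proof (induction M)
  case (Suc M)
  have "(\<Sum>v\<in>tuples D (Suc M). 1 / 2 ^ sum_list (map len v) :: real)
    = (\<Sum>i=1..D. \<Sum>v\<in>tuples D M. 1 / 2 ^ len i * (1 / 2 ^ sum_list (map len v)))"
    by (simp add: sum_tuples_Suc power_add)
  then show ?case
    by (simp only: Suc power_Suc flip: sum_product)
qed simp

text \<open>Every code word contributes \<open>2 ^ - length\<close>, spread over its coordinates; by Bessel each of the
  \<open>2 ^ n\<close> coordinates of length \<open>n\<close> receives at most weight 1 in total.\<close>

lemma orthonormal_kraft_bound:
  fixes f :: "'i \<Rightarrow> fock"
  assumes on: "orthonormal_family I f" and I: "finite I"
    and len: "\<And>i. i \<in> I \<Longrightarrow> f i \<in> tensor_power (len i)" and K: "\<And>i. i \<in> I \<Longrightarrow> len i \<le> K"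
  shows "(\<Sum>i\<in>I. 1 / 2 ^ len i) \<le> real (Suc K)"
proof -
  let ?S = "\<Union>n\<in>{..K}. {w :: bool list. length w = n}"
  have S: "finite ?S" by (intro finite_UN_I finite_length_eq) simp
  have fs: "finsupp (f i)" if "i \<in> I" for i
    using len[OF that] by (rule finsupp_tensor_power)
  have "1 / 2 ^ len i = (\<Sum>w\<in>?S. (cmod (f i w))\<^sup>2 * (1 / 2 ^ length w))" if i: "i \<in> I" for i
  proof -
    have z: "f i w = 0" if "length w \<noteq> len i" for w
      using len[OF i] that by (auto simp: tensor_power_iff)
    have "complex_of_real (\<Sum>w\<in>?S. (cmod (f i w))\<^sup>2) = cinner (f i) (f i)"
      by (subst cinner_eq_sum[OF S])
         (use z K[OF i] in \<open>auto simp: complex_norm_square mult.commute simp del: of_real_power\<close>)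
    also have "\<dots> = of_real 1"
      using on i by (simp add: orthonormal_family_def)
    finally have one: "(\<Sum>w\<in>?S. (cmod (f i w))\<^sup>2) = 1"
      by (simp only: of_real_eq_iff)
    have "(\<Sum>w\<in>?S. (cmod (f i w))\<^sup>2 * (1 / 2 ^ length w)) = (\<Sum>w\<in>?S. (cmod (f i w))\<^sup>2 * (1 / 2 ^ len i))"
      using z by (intro sum.cong) auto
    then show ?thesis
      using one by (simp only: mult_1 flip: sum_distrib_right)
  qed
  then have "(\<Sum>i\<in>I. 1 / 2 ^ len i) = (\<Sum>i\<in>I. \<Sum>w\<in>?S. (cmod (f i w))\<^sup>2 * (1 / 2 ^ length w))"
    by simp
  also have "\<dots> = (\<Sum>w\<in>?S. (\<Sum>i\<in>I. (cmod (f i w))\<^sup>2) * (1 / 2 ^ length w))"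
    unfolding sum_distrib_right by (rule sum.swap)
  also have "\<dots> \<le> (\<Sum>w\<in>?S. 1 * (1 / 2 ^ length w))"
    by (intro sum_mono mult_right_mono bessel_coordinate[OF on I fs]) auto
  also have "\<dots> = (\<Sum>n\<le>K. \<Sum>w | length (w :: bool list) = n. 1 / 2 ^ length w)"
    by (subst sum.UNION_disjoint) (auto simp: finite_length_eq)
  also have "\<dots> = real (Suc K)"
    by (simp only: sum_pow_half_length) simp
  finally show ?thesis .
qed

text \<open>For x > 1 the quotient (c * n + 1) / x ^ n tends to 0, yet the hypothesis keeps it at
  least 1.\<close>

lemma le_one_if_powers_bounded_linearly:
  fixes x c :: real
  assumes "\<And>n :: nat. n \<ge> 1 \<Longrightarrow> x ^ n \<le> c * real n + 1"
  shows "x \<le> 1"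
proof (rule ccontr)
  assume "\<not> x \<le> 1"
  then have x: "x > 1" by simp
  then have "norm (1 / x) < 1" by simp
  then have "(\<lambda>n. c * (real n * (1 / x) ^ n) + (1 / x) ^ n) \<longlonglongrightarrow> c * 0 + 0"
    by (intro tendsto_intros powser_times_n_limit_0 LIMSEQ_power_zero)
  then have "\<forall>\<^sub>F n in sequentially. c * (real n * (1 / x) ^ n) + (1 / x) ^ n < 1"
    by (rule order_tendstoD) simp
  then have "\<forall>\<^sub>F n in sequentially. c * (real n * (1 / x) ^ n) + (1 / x) ^ n < 1 \<and> n \<ge> 1"
    using eventually_ge_at_top by (rule eventually_conj)
  then obtain n :: nat where n: "c * (real n * (1 / x) ^ n) + (1 / x) ^ n < 1" "n \<ge> 1"
    using eventually_happens'[OF sequentially_bot] by blast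
  have "c * (real n * (1 / x) ^ n) + (1 / x) ^ n = (c * real n + 1) / x ^ n"
    by (simp add: power_divide add_divide_distrib)
  then have "c * real n + 1 < x ^ n"
    using n x by (simp add: divide_less_eq)
  then show False using assms[OF n(2)] by simp
qed

lemma quantum_kraft_mcmillan:
  assumes jo: "jointly_orthonormal D \<psi>"
    and len: "\<And>i. i \<in> {1..D} \<Longrightarrow> \<psi> i \<in> tensor_power (len i)"
  shows "(\<Sum>i=1..D. 1 / 2 ^ len i) \<le> (1 :: real)"
proof (rule le_one_if_powers_bounded_linearly)
  \<comment> \<open>Any common bound on the lengths that is independent of \<open>n\<close> will do;
    the sum is one, and it is meaningful for \<open>D = 0\<close> as well.\<close>
  define K where "K = (\<Sum>i=1..D. len i)"
  fix n :: nat assume n: "n \<ge> 1"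
  have "(\<Sum>v\<in>tuples D n. 1 / 2 ^ sum_list (map len v)) \<le> real (Suc (n * K))"
  proof (rule orthonormal_kraft_bound)
    show "orthonormal_family (tuples D n) (\<lambda>v. fock_concat (map \<psi> v))"
      using jo n by (simp add: jointly_orthonormal_def)
  next
    fix v assume "v \<in> tuples D n"
    then have v: "length v = n" "set v \<subseteq> {1..D}" by (auto dest!: tuples_D)
    then show "fock_concat (map \<psi> v) \<in> tensor_power (sum_list (map len v))"
      using len by (intro fock_concat_tensor_power) auto
    have "len i \<le> K" if "i \<in> set v" for i
      unfolding K_def using v that by (intro member_le_sum) auto
    then have "sum_list (map len v) \<le> sum_list (map (\<lambda>_. K) v)"
      by (intro sum_list_mono) auto
    then show "sum_list (map len v) \<le> n * K"
      using v by (simp add: sum_list_triv)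
  qed simp
  then show "(\<Sum>i=1..D. 1 / 2 ^ len i) ^ n \<le> real K * real n + 1"
    by (simp add: sum_tuples_power mult.commute)
qed

section \<open>Prefix-free words from the Kraft inequality\<close>

lemma card_extensions:
  assumes "length (u :: bool list) \<le> n"
  shows "card {w. length w = n \<and> take (length u) w = u} \<le> 2 ^ (n - length u)"
proof -
  have "{w. length w = n \<and> take (length u) w = u} \<subseteq> (\<lambda>v. u @ v) ` {v. length v = n - length u}"
  proof
    fix w assume "w \<in> {w. length w = n \<and> take (length u) w = u}"
    then have "w = u @ drop (length u) w" "length (drop (length u) w) = n - length u"
      by (metis (mono_tags) append_take_drop_id mem_Collect_eq, simp)
    then show "w \<in> (\<lambda>v. u @ v) ` {v. length v = n - length u}" by blast
  qed
  then have "card {w. length w = n \<and> take (length u) w = u}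
      \<le> card ((\<lambda>v. u @ v) ` {v :: bool list. length v = n - length u})"
    by (intro card_mono finite_imageI finite_length_eq)
  also have "\<dots> \<le> card {v :: bool list. length v = n - length u}"
    by (rule card_image_le[OF finite_length_eq])
  also have "\<dots> = 2 ^ (n - length u)"
    using card_lists_length_eq[of "UNIV :: bool set" "n - length u"] by (simp add: card_UNIV_bool)
  finally show ?thesis .
qed

text \<open>The case \<open>u = []\<close> makes the family injective, so distinctness needs no
  clause of its own.\<close>

definition prefix_free :: "'i set \<Rightarrow> ('i \<Rightarrow> 'a list) \<Rightarrow> bool" where
  "prefix_free I \<omega> \<longleftrightarrow> (\<forall>i\<in>I. \<forall>j\<in>I. \<forall>u. \<omega> i @ u = \<omega> j \<longrightarrow> i = j)"

lemma prefix_freeD: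
  "prefix_free I \<omega> \<Longrightarrow> i \<in> I \<Longrightarrow> j \<in> I \<Longrightarrow> \<omega> i @ u = \<omega> j \<Longrightarrow> i = j"
  unfolding prefix_free_def by blast

text \<open>Greedy choice in order of increasing length: the words of length \<open>len (Suc D)\<close> extending one of
  the earlier words are fewer than \<open>2 ^ len (Suc D)\<close>.\<close>

lemma kraft_converse:
  assumes "mono_on {1..D} len" "(\<Sum>i=1..D. 1 / 2 ^ len i) \<le> (1 :: real)"
  shows "\<exists>\<omega> :: nat \<Rightarrow> bool list. (\<forall>i\<in>{1..D}. length (\<omega> i) = len i) \<and> prefix_free {1..D} \<omega>"
  using assms
proof (induction D)
  case 0
  then show ?case by (simp add: prefix_free_def)
next
  case (Suc D)
  let ?n = "len (Suc D)"
  have mono: "len i \<le> ?n" if "i \<in> {1..D}" for i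
    using Suc.prems(1) that by (auto simp: mono_on_def)
  \<comment> \<open>The share of the word still to be chosen is positive; this strictness leaves
    room for it.\<close>
  have lt: "(\<Sum>i=1..D. 1 / 2 ^ len i) < (1 :: real)"
  proof -
    have "(\<Sum>i=1..D. 1 / 2 ^ len i) + 1 / 2 ^ ?n \<le> (1 :: real)" "(1 :: real) / 2 ^ ?n > 0"
      using Suc.prems(2) by auto
    then show ?thesis by linarith
  qed
  obtain \<omega> :: "nat \<Rightarrow> bool list" where \<omega>: "\<And>i. i \<in> {1..D} \<Longrightarrow> length (\<omega> i) = len i" "prefix_free {1..D} \<omega>"
    using Suc.IH Suc.prems(1) lt by (force simp: mono_on_def)
  let ?B = "\<Union>i\<in>{1..D}. {w. length w = ?n \<and> take (length (\<omega> i)) w = \<omega> i}"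
  have "real (card ?B) \<le> real (\<Sum>i=1..D. card {w. length w = ?n \<and> take (length (\<omega> i)) w = \<omega> i})"
    by (intro of_nat_mono card_UN_le) simp
  also have "\<dots> \<le> (\<Sum>i=1..D. 2 ^ (?n - len i))"
    unfolding of_nat_sum
  proof (rule sum_mono)
    fix i assume i: "i \<in> {1..D}"
    then have "card {w. length w = ?n \<and> take (length (\<omega> i)) w = \<omega> i} \<le> 2 ^ (?n - len i)"
      using card_extensions[of "\<omega> i" ?n] \<omega>(1)[OF i] mono[OF i] by simp
    then have "real (card {w. length w = ?n \<and> take (length (\<omega> i)) w = \<omega> i}) \<le> real (2 ^ (?n - len i))"
      by (simp only: of_nat_le_iff)
    then show "real (card {w. length w = ?n \<and> take (length (\<omega> i)) w = \<omega> i}) \<le> 2 ^ (?n - len i)"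
      by simp
  qed
  also have "\<dots> = 2 ^ ?n * (\<Sum>i=1..D. 1 / 2 ^ len i)"
    using mono by (simp add: sum_distrib_left power_diff)
  also have "\<dots> < real (2 ^ ?n)"
    using lt by simp
  finally have "card ?B < 2 ^ ?n"
    by (simp only: of_nat_less_iff)
  moreover have "card {w :: bool list. length w = ?n} = 2 ^ ?n"
    using card_lists_length_eq[of "UNIV :: bool set" ?n] by (simp add: card_UNIV_bool)
  moreover have "finite ?B"
    by (rule finite_subset[OF _ finite_length_eq[of ?n]]) auto
  ultimately have "\<not> {w :: bool list. length w = ?n} \<subseteq> ?B"
    using card_mono[of ?B "{w :: bool list. length w = ?n}"] by linarith
  then obtain w :: "bool list" where w: "length w = ?n" "w \<notin> ?B"
    by blast
  have new: "take (length (\<omega> i)) w \<noteq> \<omega> i" if "i \<in> {1..D}" for i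
    using w that by blast
  let ?\<omega> = "\<lambda>i. if i = Suc D then w else \<omega> i"
  have "prefix_free {1..Suc D} ?\<omega>"
    unfolding prefix_free_def
  proof (intro ballI allI impI)
    fix i j u assume ij: "i \<in> {1..Suc D}" "j \<in> {1..Suc D}" and eq: "?\<omega> i @ u = ?\<omega> j"
    consider "i \<in> {1..D}" "j \<in> {1..D}" | "i = Suc D" "j = Suc D"
      | "i \<in> {1..D}" "j = Suc D" | "i = Suc D" "j \<in> {1..D}"
      using ij by (cases "i = Suc D"; cases "j = Suc D") simp_all
    then show "i = j"
    proof cases
      case 1
      then have "\<omega> i @ u = \<omega> j" using eq by simp
      then show ?thesis using \<omega>(2) 1 unfolding prefix_free_def by blast
    next
      case 2
      then show ?thesis by simp
    next
      case 3
      then have "w = \<omega> i @ u" using eq by simp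
      then have "take (length (\<omega> i)) w = \<omega> i" by simp
      then show ?thesis using new[OF 3(1)] by contradiction
    next
      case 4
      \<comment> \<open>The new word is at least as long as every earlier one, so it can be a prefix
        of an earlier word only by being equal to it.\<close>
      then have wu: "w @ u = \<omega> j" using eq by simp
      then have "?n + length u = len j"
        using w(1) \<omega>(1)[OF 4(2)] by (simp flip: wu)
      then have "length u = 0"
        using mono[OF 4(2)] by linarith
      then have "w = \<omega> j" using wu by simp
      then have "take (length (\<omega> j)) w = \<omega> j" by simp
      then show ?thesis using new[OF 4(2)] by contradiction
    qed
  qed
  moreover have "\<forall>i\<in>{1..Suc D}. length (?\<omega> i) = len i"
    using \<omega>(1) w(1) by (auto simp: le_Suc_eq)
  ultimately show ?case by (intro exI[of _ ?\<omega>] conjI)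
qed

text \<open>The first words of two equal concatenations are prefixes of the same string, hence
  comparable, hence equal, and can be cancelled. Nonemptiness excludes the single empty word, which
  is prefix-free but not decodable.\<close>

lemma prefix_free_uniquely_decodable:
  assumes pf: "prefix_free {1..D} \<omega>" and ne: "\<And>i. i \<in> {1..D} \<Longrightarrow> \<omega> i \<noteq> []"
  shows "uniquely_decodable D \<omega>"
  unfolding uniquely_decodable_def
proof (rule inj_onI)
  fix u v assume "u \<in> lists {1..D}" "v \<in> lists {1..D}" "concat (map \<omega> u) = concat (map \<omega> v)"
  then show "u = v"
  proof (induction u arbitrary: v rule: list.induct)
    case Nil
    then show ?case using ne by (cases v) auto
  next
    case (Cons i u)
    have i: "i \<in> {1..D}" and u: "u \<in> lists {1..D}"
      using Cons.prems(1) by auto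
    obtain j v' where v: "v = j # v'"
      using Cons.prems(3) ne[OF i] by (cases v) simp_all
    have j: "j \<in> {1..D}" and v': "v' \<in> lists {1..D}"
      using Cons.prems(2) unfolding v by auto
    have eq: "\<omega> i @ concat (map \<omega> u) = \<omega> j @ concat (map \<omega> v')"
      using Cons.prems(3) v by simp
    then have "(\<exists>x. \<omega> i @ x = \<omega> j) \<or> (\<exists>x. \<omega> j @ x = \<omega> i)"
      unfolding append_eq_append_conv2 by metis
    then have "i = j"
      using pf i j unfolding prefix_free_def by blast
    moreover from this have "u = v'"
      using eq by (intro Cons.IH u v') simp
    ultimately show ?case by (simp add: v)
  qed
qed

section \<open>The classical minimization\<close>

lemma length_sequences_nonempty: "length_sequences D \<noteq> {}"
proof -
  \<comment> \<open>The constant length \<open>D\<close> is admissible because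
    \<open>D < 2 ^ D\<close>.\<close>
  have "(\<Sum>i=1..D. 1 / 2 ^ D) \<le> (1 :: real)"
    by (simp add: divide_le_eq less_imp_le)
  then have "(\<lambda>_. D) \<in> length_sequences D"
    by (simp add: length_sequences_def mono_on_def)
  then show ?thesis by blast
qed

text \<open>Infinitely many sequences may have a value below a given bound, as weights can vanish; but
  there are only finitely many such values.\<close>

lemma weighted_sum_attains_min:
  fixes \<mu> :: "nat \<Rightarrow> real"
  assumes \<mu>: "\<And>i. i \<in> I \<Longrightarrow> \<mu> i \<ge> 0" and I: "finite I" and S: "S \<noteq> {}"
  shows "\<exists>len\<in>S. \<forall>len'\<in>S. (\<Sum>i\<in>I. \<mu> i * real (len i)) \<le> (\<Sum>i\<in>I. \<mu> i * real (len' i))"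
proof -
  define G where "G len = (\<Sum>i\<in>I. \<mu> i * real (len i))" for len :: "nat \<Rightarrow> nat"
  obtain a where a: "a \<in> S" using S by blast
  define J where "J = {i \<in> I. \<mu> i > 0}"
  \<comment> \<open>A value of at most \<open>G a\<close> forces
    \<open>len i <= G a / \<mu> i\<close> for each \<open>i\<close> in \<open>J\<close>; the sum of
    these quotients dominates them all.\<close>
  define K where "K = nat \<lceil>\<Sum>i\<in>J. G a / \<mu> i\<rceil>"
  have J: "finite J" using I by (simp add: J_def)
  have GJ: "G len = (\<Sum>i\<in>J. \<mu> i * real (len i))" for len
    unfolding G_def J_def by (rule sum.mono_neutral_right) (use I \<mu> in \<open>auto simp: less_le\<close>)
  have Gpos: "G len \<ge> 0" for len
    unfolding G_def using \<mu> by (auto intro: sum_nonneg)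
  let ?V = "{G len | len. len \<in> S \<and> G len \<le> G a}"
  have "?V \<subseteq> G ` (PiE J (\<lambda>_. {..K}))"
  proof clarify
    fix len assume len: "len \<in> S" "G len \<le> G a"
    have "len i \<le> K" if i: "i \<in> J" for i
    proof -
      have "\<mu> i * real (len i) \<le> G len"
        unfolding GJ by (rule member_le_sum) (use i J in \<open>auto simp: J_def\<close>)
      then have "real (len i) \<le> G a / \<mu> i"
        using len i by (simp add: J_def le_divide_eq mult.commute)
      also have "\<dots> \<le> (\<Sum>i\<in>J. G a / \<mu> i)"
        by (rule member_le_sum) (use i J Gpos in \<open>auto simp: J_def\<close>)
      finally show ?thesis
        unfolding K_def by linarith
    qed
    \<comment> \<open>Forgetting the coordinates of weight zero keeps the value and leaves finitely
      many candidates.\<close>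
    then have "restrict len J \<in> PiE J (\<lambda>_. {..K})" by auto
    moreover have "G len = G (restrict len J)"
      unfolding GJ by (rule sum.cong) auto
    ultimately show "G len \<in> G ` (PiE J (\<lambda>_. {..K}))" by blast
  qed
  then have V: "finite ?V"
    by (rule finite_subset) (intro finite_imageI finite_PiE J, simp)
  then have "Min ?V \<in> ?V" using a by (intro Min_in) auto
  then obtain b where b: "b \<in> S" "G b \<le> G a" "G b = Min ?V" by auto
  have "G b \<le> G c" if "c \<in> S" for c
  proof (cases "G c \<le> G a")
    case True
    then have "G c \<in> ?V" using that by blast
    then show ?thesis using V b(3) by simp
  next
    case False
    then show ?thesis using b(2) by simp
  qed
  then show ?thesis using b(1) unfolding G_def by blast
qed

text \<open>Bathtub principle: a mass of \<open>card A\<close>, at most 1 per index, is cheapest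
  when it fills exactly the indices with the smallest values.\<close>

lemma sum_threshold_le:
  fixes lam c :: "'i \<Rightarrow> real"
  assumes I: "finite I" and A: "A \<subseteq> I"
    and sep: "\<And>i j. i \<in> I - A \<Longrightarrow> j \<in> A \<Longrightarrow> lam j \<le> lam i"
    and c: "\<And>j. j \<in> I \<Longrightarrow> 0 \<le> c j" "\<And>j. j \<in> I \<Longrightarrow> c j \<le> 1"
    and total: "(\<Sum>j\<in>I. c j) = real (card A)"
  shows "(\<Sum>j\<in>A. lam j) \<le> (\<Sum>j\<in>I. c j * lam j)"
proof -
  have fA: "finite A" using I A by (rule finite_subset[rotated])
  \<comment> \<open>A level separating the values on \<open>A\<close> from those off
    \<open>A\<close>. For empty \<open>A\<close> there is no maximum to take, so the least value on
    \<open>I\<close> is used.\<close>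
  obtain \<tau> where \<tau>: "\<And>j. j \<in> A \<Longrightarrow> lam j \<le> \<tau>" "\<And>i. i \<in> I - A \<Longrightarrow> \<tau> \<le> lam i"
  proof (cases "A = {}")
    case True
    then show ?thesis
      using that[of "Min (lam ` I)"] I by auto
  next
    case False
    then show ?thesis
      using that[of "Max (lam ` A)"] fA sep by auto
  qed
  \<comment> \<open>The two factors never have opposite signs: on \<open>A\<close> both are at most
    0, off \<open>A\<close> both are at least 0.\<close>
  have "(\<Sum>j\<in>I. (c j - (if j \<in> A then 1 else 0)) * (lam j - \<tau>)) \<ge> 0"
  proof (rule sum_nonneg)
    fix j assume j: "j \<in> I"
    show "0 \<le> (c j - (if j \<in> A then 1 else 0)) * (lam j - \<tau>)"
      using c[OF j] \<tau>[of j] j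
      by (cases "j \<in> A") (auto simp: mult_nonpos_nonpos)
  qed
  moreover have "(\<Sum>j\<in>I. (c j - (if j \<in> A then 1 else 0)) * (lam j - \<tau>))
      = ((\<Sum>j\<in>I. c j * lam j) - (\<Sum>j\<in>I. if j \<in> A then lam j else 0))
        - \<tau> * ((\<Sum>j\<in>I. c j) - (\<Sum>j\<in>I. if j \<in> A then 1 else 0))"
    unfolding sum_distrib_left sum_subtractf[symmetric] by (rule sum.cong) (auto simp: algebra_simps)
  moreover have "(\<Sum>j\<in>I. if j \<in> A then lam j else 0) = (\<Sum>j\<in>A. lam j)"
    "(\<Sum>j\<in>I. if j \<in> A then 1 else 0) = real (card A)"
    using A I by (simp_all add: sum.If_cases Int_absorb1)
  ultimately show ?thesis using total by simp
qed

text \<open>Layer cake: \<open>len i\<close> counts the \<open>t\<close> with \<open>t < len i\<close>, and each level set \<open>{i. t < len i}\<close> is an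
  upper segment of the index range.\<close>

lemma doubly_stochastic_rearrangement:
  fixes lam :: "nat \<Rightarrow> real" and b :: "nat \<Rightarrow> nat \<Rightarrow> real" and len :: "nat \<Rightarrow> nat"
  assumes lam: "antimono_on {1..D} lam" and len: "mono_on {1..D} len"
    and b: "\<And>i j. b i j \<ge> 0"
    and row: "\<And>i. i \<in> {1..D} \<Longrightarrow> (\<Sum>j=1..D. b i j) = 1"
    and col: "\<And>j. j \<in> {1..D} \<Longrightarrow> (\<Sum>i=1..D. b i j) = 1"
  shows "(\<Sum>i=1..D. lam i * real (len i)) \<le> (\<Sum>i=1..D. (\<Sum>j=1..D. lam j * b i j) * real (len i))"
proof -
  define K where "K = (\<Sum>i=1..D. len i)"
  let ?A = "\<lambda>t. {i \<in> {1..D}. t < len i}"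
  have cake: "(\<Sum>i=1..D. f i * real (len i)) = (\<Sum>t<K. \<Sum>i\<in>?A t. f i)" for f
  proof -
    have "f i * real (len i) = (\<Sum>t<K. if t < len i then f i else 0)" if i: "i \<in> {1..D}" for i
    proof -
      have "len i \<le> K" unfolding K_def using i by (intro member_le_sum) auto
      then have "{..<K} \<inter> {t. t < len i} = {..<len i}" by auto
      then show ?thesis by (simp add: sum.If_cases mult.commute)
    qed
    then have "(\<Sum>i=1..D. f i * real (len i)) = (\<Sum>i=1..D. \<Sum>t<K. if t < len i then f i else 0)"
      by simp
    also have "\<dots> = (\<Sum>t<K. \<Sum>i=1..D. if t < len i then f i else 0)"
      by (rule sum.swap)
    also have "\<dots> = (\<Sum>t<K. \<Sum>i\<in>?A t. f i)"
      by (simp only: sum.inter_filter finite_atLeastAtMost)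
    finally show ?thesis .
  qed
  have "(\<Sum>i\<in>?A t. lam i) \<le> (\<Sum>i\<in>?A t. \<Sum>j=1..D. lam j * b i j)" for t
  proof -
    \<comment> \<open>Column sums restricted to the level set are weights between 0 and 1, and by
      the row sums their total is the size of the level set.\<close>
    have "(\<Sum>i\<in>?A t. lam i) \<le> (\<Sum>j=1..D. (\<Sum>i\<in>?A t. b i j) * lam j)"
    proof (rule sum_threshold_le)
      fix i j assume ij: "i \<in> {1..D} - ?A t" "j \<in> ?A t"
      then have "len i < len j" by auto
      then have "i \<le> j"
        using mono_onD[OF len, of j i] ij by (cases "i \<le> j") simp_all
      then show "lam j \<le> lam i"
        using lam ij by (auto simp: monotone_on_def)
    next
      fix j assume j: "j \<in> {1..D}"
      show "0 \<le> (\<Sum>i\<in>?A t. b i j)" using b by (intro sum_nonneg)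
      show "(\<Sum>i\<in>?A t. b i j) \<le> 1"
        unfolding col[OF j, symmetric] using b by (intro sum_mono2) auto
    next
      show "(\<Sum>j=1..D. \<Sum>i\<in>?A t. b i j) = real (card (?A t))"
      proof -
        have "(\<Sum>i\<in>?A t. \<Sum>j=1..D. b i j) = (\<Sum>i\<in>?A t. 1)"
          by (rule sum.cong) (simp_all only: row mem_Collect_eq)
        then show ?thesis by (subst sum.swap) simp
      qed
    qed auto
    also have "\<dots> = (\<Sum>i\<in>?A t. \<Sum>j=1..D. lam j * b i j)"
      unfolding sum_distrib_right by (subst sum.swap) (simp add: mult.commute)
    finally show ?thesis .
  qed
  then show ?thesis
    unfolding cake by (rule sum_mono)
qed

text \<open>A code lists its codewords in any order, whereas \<open>length_sequences\<close> demands
  increasing lengths; this permutation mediates.\<close>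

lemma sorting_bijection:
  fixes len :: "nat \<Rightarrow> nat"
  shows "\<exists>\<sigma>. bij_betw \<sigma> {1..D} {1..D} \<and> mono_on {1..D} (len \<circ> \<sigma>)"
proof -
  define xs where "xs = sort_key len [1..<D + 1]"
  have xs: "distinct xs" "set xs = {1..D}" "length xs = D" "sorted (map len xs)"
    by (auto simp: xs_def)
  let ?\<sigma> = "\<lambda>i. xs ! (i - 1)"
  have "bij_betw ((!) xs) {..<D} {1..D}"
    using xs by (intro bij_betw_nth) auto
  moreover have "bij_betw (\<lambda>i. i - 1) {1..D} {..<D}"
    by (rule bij_betw_byWitness[of _ "\<lambda>i. i + 1"]) auto
  ultimately have "bij_betw ((!) xs \<circ> (\<lambda>i. i - 1)) {1..D} {1..D}"
    using bij_betw_trans by blast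
  moreover have "mono_on {1..D} (len \<circ> ?\<sigma>)"
  proof (rule mono_onI)
    fix i j assume "i \<in> {1..D}" "j \<in> {1..D}" "i \<le> j"
    then have "map len xs ! (i - 1) \<le> map len xs ! (j - 1)"
      using xs by (intro sorted_nth_mono) auto
    then show "(len \<circ> ?\<sigma>) i \<le> (len \<circ> ?\<sigma>) j"
      using xs \<open>i \<in> {1..D}\<close> \<open>j \<in> {1..D}\<close> by (auto simp: nth_map)
  qed
  ultimately show ?thesis by (auto simp: comp_def)
qed

section \<open>Marginals of the source\<close>

lemma source_event_measurable:
  assumes "quantum_stochastic_source M X N s"
  shows "{\<omega> \<in> space M. \<forall>i<length ns. X (i + 1) \<omega> = ns ! i} \<in> sets M"
proof -
  have "{\<omega> \<in> space M. X (i + 1) \<omega> = a} \<in> sets M" for i a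
  proof -
    have X: "X (i + 1) \<in> measurable M (count_space {1..N})"
      using assms by (simp add: quantum_stochastic_source_def)
    \<comment> \<open>The letter \<open>a\<close> may lie outside the alphabet; intersecting with
      \<open>{1..N}\<close> gives a measurable set of the target with the same preimage.\<close>
    have "X (i + 1) -` ({a} \<inter> {1..N}) \<inter> space M \<in> sets M"
      by (rule measurable_sets[OF X]) auto
    moreover have "X (i + 1) -` ({a} \<inter> {1..N}) \<inter> space M = {\<omega> \<in> space M. X (i + 1) \<omega> = a}"
      using measurable_space[OF X] by auto
    ultimately show ?thesis by simp
  qed
  then have "{\<omega> \<in> space M. \<forall>i\<in>{..<length ns}. X (i + 1) \<omega> = ns ! i} \<in> sets M"
    by (intro sets.sets_Collect_finite_All) auto
  then show ?thesis by (simp only: Ball_def lessThan_iff)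
qed

lemma mass_function_snoc:
  assumes src: "quantum_stochastic_source M X N s"
  shows "mass_function M X ns = (\<Sum>a=1..N. mass_function M X (ns @ [a]))"
proof -
  interpret prob_space M
    using src by (simp add: quantum_stochastic_source_def)
  let ?E = "\<lambda>ns. {\<omega> \<in> space M. \<forall>i<length ns. X (i + 1) \<omega> = ns ! i}"
  have snoc: "?E (ns @ [a]) = {\<omega> \<in> ?E ns. X (length ns + 1) \<omega> = a}" for a
    by (auto simp: nth_append less_Suc_eq)
  have "X (length ns + 1) \<omega> \<in> {1..N}" if "\<omega> \<in> space M" for \<omega>
  proof -
    have "X (length ns + 1) \<in> measurable M (count_space {1..N})"
      using src by (simp add: quantum_stochastic_source_def)
    from measurable_space[OF this that] show ?thesis by simp
  qed
  then have "?E ns = (\<Union>a\<in>{1..N}. ?E (ns @ [a]))"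
    unfolding snoc by blast
  moreover have "measure M (\<Union>a\<in>{1..N}. ?E (ns @ [a])) = (\<Sum>a\<in>{1..N}. measure M (?E (ns @ [a])))"
  proof (rule finite_measure_finite_Union)
    show "(\<lambda>a. ?E (ns @ [a])) ` {1..N} \<subseteq> sets M"
      using source_event_measurable[OF src] by blast
    show "disjoint_family_on (\<lambda>a. ?E (ns @ [a])) {1..N}"
      unfolding snoc disjoint_family_on_def by blast
  qed simp
  ultimately show ?thesis
    unfolding mass_function_def by simp
qed

lemma mass_function_append:
  assumes "quantum_stochastic_source M X N s"
  shows "mass_function M X ns = (\<Sum>v\<in>tuples N r. mass_function M X (ns @ v))"
proof (induction r arbitrary: ns)
  case (Suc r)
  have "mass_function M X ns = (\<Sum>a=1..N. mass_function M X (ns @ [a]))"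
    by (rule mass_function_snoc[OF assms])
  also have "\<dots> = (\<Sum>a=1..N. \<Sum>v\<in>tuples N r. mass_function M X ((ns @ [a]) @ v))"
    by (intro sum.cong refl Suc)
  finally show ?case by (simp add: sum_tuples_Suc)
qed simp

text \<open>The average length weights all \<open>m * l\<close> emissions, the \<open>k\<close>-th
  ensemble state only the first \<open>k * l\<close>; this reconciles the two.\<close>

lemma mass_function_marginal:
  assumes "quantum_stochastic_source M X N s" and "q \<le> r"
  shows "(\<Sum>ns\<in>tuples N r. mass_function M X ns * g (take q ns))
    = (\<Sum>ns\<in>tuples N q. mass_function M X ns * g ns)"
proof -
  obtain t where r: "r = q + t" using \<open>q \<le> r\<close> le_Suc_ex by blast
  have "(\<Sum>ns\<in>tuples N r. mass_function M X ns * g (take q ns))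
      = (\<Sum>u\<in>tuples N q. \<Sum>v\<in>tuples N t. mass_function M X (u @ v) * g u)"
    unfolding r sum_tuples_add by (intro sum.cong refl) (auto dest!: tuples_D)
  also have "\<dots> = (\<Sum>u\<in>tuples N q. mass_function M X u * g u)"
    by (simp only: mass_function_append[OF assms(1), where r = t, symmetric] flip: sum_distrib_right)
  finally show ?thesis .
qed

section \<open>Block ensemble states\<close>

lemma block_tuples:
  assumes "ns \<in> tuples N q" "k \<ge> 1" "k * l \<le> q"
  shows "block l k ns \<in> tuples N l"
proof -
  have "(k - 1) * l + l = k * l" using assms(2) by (cases k) auto
  moreover have "set (block l k ns) \<subseteq> set ns"
    unfolding block_def by (meson set_drop_subset set_take_subset subset_trans)
  ultimately show ?thesis
    using assms by (auto simp: tuples_def block_def)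
qed

lemma block_take:
  assumes "k \<ge> 1"
  shows "block l k (take (k * l) ns) = block l k ns"
proof -
  have "k * l = l + (k - 1) * l" using assms by (cases k) auto
  then have "drop ((k - 1) * l) (take (k * l) ns) = take l (drop ((k - 1) * l) ns)"
    by (metis take_drop)
  then show ?thesis
    by (simp add: block_def)
qed

lemma block_vector_in_tensor_power:
  fixes s :: "nat \<Rightarrow> complex ^ 'd :: finite"
  assumes "ns \<in> tuples N q" "k \<ge> 1" "k * l \<le> q"
  shows "block_vector s l k ns \<in> tensor_power l"
proof -
  have "length (block l k ns) = l"
    using tuples_D[OF block_tuples[OF assms]] by simp
  then show ?thesis
    using tensor_in_tensor_power[of "map s (block l k ns)"] by (simp add: block_vector_def)
qed

lemma cinner_block_vector_self:
  fixes s :: "nat \<Rightarrow> complex ^ 'd :: finite"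
  assumes "quantum_stochastic_source M X N s" "ns \<in> tuples N q" "k \<ge> 1" "k * l \<le> q"
  shows "cinner (block_vector s l k ns) (block_vector s l k ns) = 1"
  unfolding block_vector_def
proof (rule cinner_tensor_self)
  fix v assume "v \<in> set (map s (block l k ns))"
  then obtain i where "v = s i" "i \<in> {1..N}"
    using tuples_D[OF block_tuples[OF assms(2-4)]] by auto
  then show "norm v = 1"
    using assms(1) by (simp add: quantum_stochastic_source_def)
qed

text \<open>The expectation of the \<open>k\<close>-th block ensemble state in the vector
  \<open>u\<close>, written as a real sum of transition probabilities so that its sign is
  visible.\<close>

definition block_weight ::
  "(nat list \<Rightarrow> real) \<Rightarrow> nat \<Rightarrow> (nat \<Rightarrow> complex ^ 'd) \<Rightarrow> nat \<Rightarrow> nat \<Rightarrow> 'd list vect \<Rightarrow> real" where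
  "block_weight p N s l k u =
     (\<Sum>ns\<in>tuples N (k * l). p ns * (cmod (cinner u (block_vector s l k ns)))\<^sup>2)"

lemma block_weight_eq_cinner:
  fixes s :: "nat \<Rightarrow> complex ^ 'd :: finite"
  assumes u: "u \<in> tensor_power l" and k: "k \<ge> 1"
  shows "cinner u (block_ensemble_state p N s l k u) = of_real (block_weight p N s l k u)"
proof -
  let ?b = "block_vector s l k" and ?T = "tuples N (k * l)"
  have fu: "finsupp u" using u by (rule finsupp_tensor_power)
  have "block_ensemble_state p N s l k u = (\<lambda>w. \<Sum>ns\<in>?T. (of_real (p ns) * cinner (?b ns) u) * ?b ns w)"
    by (simp add: block_ensemble_state_def ketbra_def mult_ac)
  then have "cinner u (block_ensemble_state p N s l k u)
      = (\<Sum>ns\<in>?T. (of_real (p ns) * cinner (?b ns) u) * cinner u (?b ns))"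
    using fu by (simp only: cinner_sum_right)
  also have "\<dots> = (\<Sum>ns\<in>?T. of_real (p ns * (cmod (cinner u (?b ns)))\<^sup>2))"
    by (intro sum.cong refl)
       (simp add: cinner_commute[OF fu] complex_norm_square mult_ac del: of_real_power)
  finally show ?thesis
    by (simp add: block_weight_def)
qed

lemma block_weight_spectral:
  fixes s :: "nat \<Rightarrow> complex ^ 'd :: finite" and e :: "nat \<Rightarrow> 'd list vect"
  assumes k: "k \<ge> 1" and u: "u \<in> tensor_power l"
    and basis: "orthonormal_basis (tensor_power l) {1..D} e"
    and eig: "\<And>i. i \<in> {1..D} \<Longrightarrow>
      block_ensemble_state p N s l k (e i) = (\<lambda>w. complex_of_real (lam i) * e i w)"
  shows "block_weight p N s l k u = (\<Sum>j=1..D. lam j * (cmod (cinner (e j) u))\<^sup>2)"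
proof -
  let ?b = "block_vector s l k" and ?T = "tuples N (k * l)" and ?c = "\<lambda>j. cinner (e j) u"
  have fu: "finsupp u" using u by (rule finsupp_tensor_power)
  have fe: "finsupp (e j)" if "j \<in> {1..D}" for j
    using basis that unfolding orthonormal_basis_def by (auto intro: finsupp_tensor_power)
  have ue: "u = (\<lambda>w. \<Sum>j=1..D. ?c j * e j w)"
    by (rule basis_expand[OF basis _ u]) simp
  have cu: "cinner (?b ns) u = (\<Sum>j=1..D. ?c j * cinner (?b ns) (e j))" if "ns \<in> ?T" for ns
  proof -
    have "finsupp (?b ns)"
      using that k by (intro finsupp_tensor_power[OF block_vector_in_tensor_power]) auto
    then have "cinner (?b ns) (\<lambda>w. \<Sum>j=1..D. ?c j * e j w) = (\<Sum>j=1..D. ?c j * cinner (?b ns) (e j))"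
      by (rule cinner_sum_right)
    then show ?thesis using ue by simp
  qed
  \<comment> \<open>Linearity of the ensemble state in coordinates: the sums over emissions and over
    the eigenbasis are exchanged.\<close>
  have "block_ensemble_state p N s l k u w = (\<Sum>j=1..D. (?c j * of_real (lam j)) * e j w)" for w
  proof -
    have "block_ensemble_state p N s l k u w
        = (\<Sum>ns\<in>?T. \<Sum>j=1..D. ?c j * (of_real (p ns) * ketbra (?b ns) (?b ns) (e j) w))"
      unfolding block_ensemble_state_def ketbra_def
      by (intro sum.cong refl) (simp add: cu sum_distrib_left mult_ac)
    also have "\<dots> = (\<Sum>j=1..D. ?c j * block_ensemble_state p N s l k (e j) w)"
      by (subst sum.swap) (simp add: block_ensemble_state_def sum_distrib_left)
    also have "\<dots> = (\<Sum>j=1..D. (?c j * of_real (lam j)) * e j w)"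
      by (intro sum.cong refl) (simp add: eig)
    finally show ?thesis .
  qed
  then have "block_ensemble_state p N s l k u = (\<lambda>w. \<Sum>j=1..D. (?c j * of_real (lam j)) * e j w)"
    by blast
  then have "cinner u (block_ensemble_state p N s l k u)
      = (\<Sum>j=1..D. (?c j * of_real (lam j)) * cinner u (e j))"
    using fu by (simp only: cinner_sum_right)
  also have "\<dots> = (\<Sum>j=1..D. of_real (lam j * (cmod (?c j))\<^sup>2))"
    by (intro sum.cong refl)
       (simp add: cinner_commute[OF fe] complex_norm_square mult_ac del: of_real_power)
  finally have "complex_of_real (block_weight p N s l k u) = of_real (\<Sum>j=1..D. lam j * (cmod (?c j))\<^sup>2)"
    unfolding block_weight_eq_cinner[OF u k] by simp
  then show ?thesis
    by (simp only: of_real_eq_iff)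
qed

text \<open>Evaluates the code built on eigenvectors, and is also the source of the nonnegativity of
  the eigenvalues.\<close>

lemma block_weight_eigenvector:
  fixes s :: "nat \<Rightarrow> complex ^ 'd :: finite" and e :: "nat \<Rightarrow> 'd list vect"
  assumes k: "k \<ge> 1" and basis: "orthonormal_basis (tensor_power l) {1..D} e" and i: "i \<in> {1..D}"
    and eig: "\<And>i. i \<in> {1..D} \<Longrightarrow>
      block_ensemble_state p N s l k (e i) = (\<lambda>w. complex_of_real (lam i) * e i w)"
  shows "block_weight p N s l k (e i) = lam i"
proof -
  have "block_weight p N s l k (e i) = (\<Sum>j=1..D. lam j * (cmod (cinner (e j) (e i)))\<^sup>2)"
    by (rule block_weight_spectral[OF k _ basis eig])
       (use basis i in \<open>auto simp: orthonormal_basis_def\<close>)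
  also have "\<dots> = (\<Sum>j=1..D. if j = i then lam i else 0)"
    using basis i by (intro sum.cong refl) (auto simp: orthonormal_basis_def orthonormal_family_def)
  finally show ?thesis using i by simp
qed

section \<open>Codes\<close>

text \<open>Holds for arbitrary bases and unsorted lengths, so it serves both the lower bound for
  all codes and the evaluation of the optimal one.\<close>

lemma average_length_code:
  fixes s :: "nat \<Rightarrow> complex ^ 'd :: finite"
  assumes src: "quantum_stochastic_source M X N s" and p: "p = mass_function M X" and m: "m \<ge> 1"
    and jo: "jointly_orthonormal D \<psi>"
    and len: "\<And>i. i \<in> {1..D} \<Longrightarrow> \<psi> i \<in> tensor_power (len i)"
    and basis: "\<And>k. k \<in> {1..m} \<Longrightarrow> orthonormal_basis (tensor_power l) {1..D} (e k)"
    and U: "\<And>k v. k \<in> {1..m} \<Longrightarrow> v \<in> tensor_power l \<Longrightarrow> U k v = code_map D \<psi> (e k) v"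
  shows "average_length p N s m l U
    = (\<Sum>k=1..m. \<Sum>i=1..D. block_weight p N s l k (e k i) * real (len i))"
proof -
  let ?b = "block_vector s l" and ?T = "tuples N (m * l)"
  have trace: "Re (fock_trace (ketbra (encoded_state s m l U ns) (encoded_state s m l U ns) \<circ> length_observable))
      = (\<Sum>k=1..m. \<Sum>i=1..D. (cmod (cinner (e k i) (?b k ns)))\<^sup>2 * real (len i))" if ns: "ns \<in> ?T" for ns
  proof -
    let ?cs = "map (\<lambda>k i. cinner (e k i) (?b k ns)) [1..<m + 1]"
    have b: "?b k ns \<in> tensor_power l" "cinner (?b k ns) (?b k ns) = 1" if "k \<in> {1..m}" for k
    proof -
      have "k \<ge> 1" "k * l \<le> m * l" using that by simp_all
      then show "?b k ns \<in> tensor_power l" "cinner (?b k ns) (?b k ns) = 1"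
        using block_vector_in_tensor_power[OF ns] cinner_block_vector_self[OF src ns] by blast+
    qed
    have "fock_trace (ketbra (encoded_state s m l U ns) (encoded_state s m l U ns) \<circ> length_observable)
        = of_real (\<Sum>c\<leftarrow>?cs. \<Sum>i=1..D. (cmod (c i))\<^sup>2 * real (len i))"
    proof (rule expected_length[OF _ len])
      show "orthonormal_family (tuples D (length ?cs)) (\<lambda>v. fock_concat (map \<psi> v))"
        using jo m by (simp add: jointly_orthonormal_def)
    next
      fix c assume "c \<in> set ?cs"
      then obtain k where k: "k \<in> set [1..<m + 1]" and c: "c = (\<lambda>i. cinner (e k i) (?b k ns))"
        unfolding set_map by blast
      then have k: "k \<in> {1..m}" by (simp del: upt_Suc)
      show "(\<Sum>i=1..D. (cmod (c i))\<^sup>2) = 1"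
        unfolding c by (rule parseval_norm[OF basis[OF k] _ b[OF k]]) simp
    next
      have "U k (?b k ns) = (\<lambda>w. \<Sum>i=1..D. cinner (e k i) (?b k ns) * \<psi> i w)" if "k \<in> {1..m}" for k
        using U[OF that b(1)[OF that]] by (simp add: code_map_def ketbra_def mult.commute)
      then show "encoded_state s m l U ns = fock_concat (map (\<lambda>c w. \<Sum>i=1..D. c i * \<psi> i w) ?cs)"
        unfolding encoded_state_def map_map
        by (intro arg_cong[where f = fock_concat] map_cong) auto
    qed
    moreover have "(\<Sum>c\<leftarrow>?cs. \<Sum>i=1..D. (cmod (c i))\<^sup>2 * real (len i))
        = (\<Sum>k\<leftarrow>[1..<m + 1]. \<Sum>i=1..D. (cmod (cinner (e k i) (?b k ns)))\<^sup>2 * real (len i))"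
      by (simp add: comp_def)
    moreover have "\<dots> = (\<Sum>k=1..m. \<Sum>i=1..D. (cmod (cinner (e k i) (?b k ns)))\<^sup>2 * real (len i))"
    proof -
      have "set [1..<m + 1] = {1..m}" by auto
      then show ?thesis
        using sum_list_distinct_conv_sum_set[OF distinct_upt, of _ 1 "m + 1"] by (simp only:)
    qed
    ultimately show ?thesis by simp
  qed
  have "average_length p N s m l U
      = (\<Sum>ns\<in>?T. p ns * (\<Sum>k=1..m. \<Sum>i=1..D. (cmod (cinner (e k i) (?b k ns)))\<^sup>2 * real (len i)))"
    unfolding average_length_def by (rule sum.cong) (simp_all add: trace)
  also have "\<dots> = (\<Sum>ns\<in>?T. \<Sum>k=1..m. \<Sum>i=1..D. (p ns * (cmod (cinner (e k i) (?b k ns)))\<^sup>2) * real (len i))"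
    by (simp add: sum_distrib_left mult.assoc)
  also have "\<dots> = (\<Sum>k=1..m. \<Sum>i=1..D. \<Sum>ns\<in>?T. (p ns * (cmod (cinner (e k i) (?b k ns)))\<^sup>2) * real (len i))"
    by (subst sum.swap) (intro sum.cong refl sum.swap)
  also have "\<dots> = (\<Sum>k=1..m. \<Sum>i=1..D. block_weight p N s l k (e k i) * real (len i))"
  proof (intro sum.cong refl)
    fix k i assume k: "k \<in> {1..m}"
    then have "?b k (take (k * l) ns) = ?b k ns" for ns
      by (simp add: block_vector_def block_take)
    moreover have "k * l \<le> m * l" using k by simp
    ultimately have "(\<Sum>ns\<in>?T. p ns * (cmod (cinner (e k i) (?b k ns)))\<^sup>2) = block_weight p N s l k (e k i)"
      using mass_function_marginal[OF src, of "k * l" "m * l" "\<lambda>ns. (cmod (cinner (e k i) (?b k ns)))\<^sup>2"]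
      by (simp add: block_weight_def p)
    then show "(\<Sum>ns\<in>?T. (p ns * (cmod (cinner (e k i) (?b k ns)))\<^sup>2) * real (len i))
        = block_weight p N s l k (e k i) * real (len i)"
      by (simp flip: sum_distrib_right)
  qed
  finally show ?thesis .
qed

text \<open>The weights \<open>block_weight (e' i)\<close> are the image of the eigenvalues under the doubly stochastic
  matrix \<open>\<bar>\<langle>e j, e' i\<rangle>\<bar>\<^sup>2\<close>.\<close>

lemma block_weight_lower_bound:
  fixes s :: "nat \<Rightarrow> complex ^ 'd :: finite" and e e' :: "nat \<Rightarrow> 'd list vect" and len :: "nat \<Rightarrow> nat"
  assumes k: "k \<ge> 1"
    and basis: "orthonormal_basis (tensor_power l) {1..D} e"
    and eig: "\<And>i. i \<in> {1..D} \<Longrightarrow>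
      block_ensemble_state p N s l k (e i) = (\<lambda>w. complex_of_real (lam i) * e i w)"
    and lam: "antimono_on {1..D} lam"
    and basis': "orthonormal_basis (tensor_power l) {1..D} e'"
    and \<sigma>: "bij_betw \<sigma> {1..D} {1..D}" "mono_on {1..D} (len \<circ> \<sigma>)"
  shows "(\<Sum>i=1..D. lam i * real (len (\<sigma> i))) \<le> (\<Sum>i=1..D. block_weight p N s l k (e' i) * real (len i))"
proof -
  \<comment> \<open>Row \<open>i\<close> belongs to the basis vector carrying the
    \<open>i\<close>-th smallest length, which lines the rows up with the decreasing
    eigenvalues.\<close>
  define b where "b i j = (cmod (cinner (e j) (e' (\<sigma> i))))\<^sup>2" for i j
  have e: "e i \<in> tensor_power l" "cinner (e i) (e i) = 1" if "i \<in> {1..D}" for i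
    using basis that by (auto simp: orthonormal_basis_def orthonormal_family_def)
  have e': "e' i \<in> tensor_power l" "cinner (e' i) (e' i) = 1" if "i \<in> {1..D}" for i
    using basis' that by (auto simp: orthonormal_basis_def orthonormal_family_def)
  have \<sigma>D: "\<sigma> i \<in> {1..D}" if "i \<in> {1..D}" for i
    using \<sigma>(1) that by (auto simp: bij_betw_def)
  have "(\<Sum>i=1..D. lam i * real ((len \<circ> \<sigma>) i)) \<le> (\<Sum>i=1..D. (\<Sum>j=1..D. lam j * b i j) * real ((len \<circ> \<sigma>) i))"
  proof (rule doubly_stochastic_rearrangement[OF lam \<sigma>(2)])
    show "b i j \<ge> 0" for i j by (simp add: b_def)
  next
    fix i assume i: "i \<in> {1..D}"
    show "(\<Sum>j=1..D. b i j) = 1"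
      unfolding b_def by (rule parseval_norm[OF basis _ e'[OF \<sigma>D[OF i]]]) simp
  next
    fix j assume j: "j \<in> {1..D}"
    have "(\<Sum>i=1..D. b i j) = (\<Sum>i=1..D. (cmod (cinner (e j) (e' i)))\<^sup>2)"
      unfolding b_def by (rule sum.reindex_bij_betw[OF \<sigma>(1), of "\<lambda>i. (cmod (cinner (e j) (e' i)))\<^sup>2"])
    \<comment> \<open>Conjugate symmetry turns the column into a Parseval sum of \<open>e j\<close>
      in the other basis.\<close>
    also have "\<dots> = (\<Sum>i=1..D. (cmod (cinner (e' i) (e j)))\<^sup>2)"
      using e(1)[OF j] by (intro sum.cong refl) (simp add: cinner_commute[of "e j"] finsupp_tensor_power)
    also have "\<dots> = 1"
      by (rule parseval_norm[OF basis' _ e[OF j]]) simp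
    finally show "(\<Sum>i=1..D. b i j) = 1" .
  qed
  also have "\<dots> = (\<Sum>i=1..D. block_weight p N s l k (e' (\<sigma> i)) * real (len (\<sigma> i)))"
  proof (intro sum.cong refl)
    fix i assume "i \<in> {1..D}"
    then have "block_weight p N s l k (e' (\<sigma> i)) = (\<Sum>j=1..D. lam j * b i j)"
      unfolding b_def by (intro block_weight_spectral[OF k _ basis eig] e' \<sigma>D)
    then show "(\<Sum>j=1..D. lam j * b i j) * real ((len \<circ> \<sigma>) i) = block_weight p N s l k (e' (\<sigma> i)) * real (len (\<sigma> i))"
      by simp
  qed
  also have "\<dots> = (\<Sum>i=1..D. block_weight p N s l k (e' i) * real (len i))"
    by (rule sum.reindex_bij_betw[OF \<sigma>(1), of "\<lambda>i. block_weight p N s l k (e' i) * real (len i)"])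
  finally show ?thesis by simp
qed

section \<open>Codes built from classical bit strings\<close>

lemma code_map_isometry:
  fixes e :: "nat \<Rightarrow> 'd :: finite list vect"
  assumes on: "orthonormal_family {1..D} \<psi>" and fs: "\<And>i. i \<in> {1..D} \<Longrightarrow> finsupp (\<psi> i)"
    and basis: "orthonormal_basis (tensor_power l) {1..D} e"
  shows "isometry_into (tensor_power l) fock_space (code_map D \<psi> e)"
proof -
  have cm: "code_map D \<psi> e v = (\<lambda>w. \<Sum>i=1..D. cinner (e i) v * \<psi> i w)" for v
    by (simp add: code_map_def ketbra_def mult.commute)
  have fe: "finsupp (e i)" if "i \<in> {1..D}" for i
    using basis that unfolding orthonormal_basis_def by (auto intro: finsupp_tensor_power)
  have lin: "cinner (e i) (\<lambda>x. a * u x + b * v x) = a * cinner (e i) u + b * cinner (e i) v"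
    if "i \<in> {1..D}" for i a b u v
    \<comment> \<open>A combination of two vectors is presented as a sum over
      \<open>bool\<close>.\<close>
    using cinner_sum_right[OF fe[OF that], of "\<lambda>t. if t then a else b" "\<lambda>t. if t then u else v" UNIV]
    by (simp add: UNIV_bool add.commute)
  show ?thesis
    unfolding isometry_into_def
  proof (intro conjI ballI allI)
    fix v
    show "code_map D \<psi> e v \<in> fock_space"
      unfolding fock_space_def cm using fs by (intro finsupp_ell2 finsupp_sum) auto
  next
    fix u v a b
    show "code_map D \<psi> e (\<lambda>x. a * u x + b * v x) = (\<lambda>y. a * code_map D \<psi> e u y + b * code_map D \<psi> e v y)"
      unfolding cm by (simp add: lin sum_distrib_left sum.distrib algebra_simps)
  next
    fix u v :: "'d list vect"
    assume uv: "u \<in> tensor_power l" "v \<in> tensor_power l"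
    have "cinner (code_map D \<psi> e u) (code_map D \<psi> e v) = (\<Sum>i=1..D. cnj (cinner (e i) u) * cinner (e i) v)"
      unfolding cm by (rule cinner_orthonormal[OF on _ fs]) auto
    also have "\<dots> = cinner u v"
      by (rule parseval[OF basis _ uv, symmetric]) simp
    finally show "cinner (code_map D \<psi> e u) (code_map D \<psi> e v) = cinner u v" .
  qed
qed

lemma ket_length_codeword: "length_codeword (ket w)"
  unfolding length_codeword_def unit_vector_def
  using ket_in_tensor_power[of w] by (auto simp: cinner_ket finsupp_ell2) (auto simp: ket_def)

text \<open>Injectivity on tuples of equal length is weaker than unique decodability and covers the
  single empty word.\<close>

lemma kets_jointly_orthonormal:
  fixes \<omega> :: "nat \<Rightarrow> bool list"
  assumes "\<And>n. inj_on (\<lambda>v. concat (map \<omega> v)) (tuples D n)"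
  shows "jointly_orthonormal D (\<lambda>i. ket (\<omega> i))"
proof -
  have "unit_vector (ket w)" for w :: "bool list"
    using ket_length_codeword[of w] by (auto simp: length_codeword_def)
  moreover have "cinner (ket (concat (map \<omega> u))) (ket (concat (map \<omega> v))) = (if u = v then 1 else 0)"
    if "u \<in> tuples D n" "v \<in> tuples D n" for u v n
    using inj_onD[OF assms _ that] by (auto simp: cinner_ket) (auto simp: ket_def)
  ultimately show ?thesis
    unfolding jointly_orthonormal_def orthonormal_family_def fock_space_def
    by (auto simp: fock_concat_ket finsupp_ell2)
qed

text \<open>For \<open>D = 1\<close> there is one tuple of each length, so any word at all will
  do.\<close>

lemma concat_inj_on_tuples:
  assumes "D = 1 \<or> uniquely_decodable D \<omega>"
  shows "inj_on (\<lambda>v. concat (map \<omega> v)) (tuples D n)"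
  using assms
proof
  assume "D = 1"
  have "v = replicate n 1" if "v \<in> tuples D n" for v
    using that \<open>D = 1\<close> by (intro replicate_eqI) (auto simp: tuples_def)
  then show ?thesis by (auto intro: inj_onI)
next
  assume "uniquely_decodable D \<omega>"
  then show ?thesis
    unfolding uniquely_decodable_def by (rule inj_on_subset) (auto simp: tuples_def)
qed

lemma ket_code:
  fixes e :: "nat \<Rightarrow> nat \<Rightarrow> 'd :: finite list vect"
  assumes D: "D = CARD('d) ^ l" and ud: "D = 1 \<or> uniquely_decodable D \<omega>"
    and basis: "\<And>k. k \<in> {1..m} \<Longrightarrow> orthonormal_basis (tensor_power l) {1..D} (e k)"
  shows "constrained_special_block_code m l (\<lambda>k. code_map D (\<lambda>i. ket (\<omega> i)) (e k))"
proof -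
  have jo: "jointly_orthonormal D (\<lambda>i. ket (\<omega> i))"
    by (rule kets_jointly_orthonormal) (rule concat_inj_on_tuples[OF ud])
  \<comment> \<open>Tuples of length 1 give distinct codewords.\<close>
  have inj: "i = j" if "i \<in> {1..D}" "j \<in> {1..D}" "\<omega> i = \<omega> j" for i j
    using inj_onD[OF concat_inj_on_tuples[OF ud, of 1], of "[i]" "[j]"] that by (auto simp: tuples_def)
  then have on: "orthonormal_family {1..D} (\<lambda>i. ket (\<omega> i))"
    by (auto simp: orthonormal_family_def finsupp_ell2 cinner_ket) (auto simp: ket_def)
  show ?thesis
    unfolding constrained_special_block_code_def D[symmetric]
    using code_map_isometry[OF on _ basis] jo basis ket_length_codeword
    by (intro conjI exI[of _ "\<lambda>i. ket (\<omega> i)"] exI[of _ e]) auto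
qed

text \<open>For \<open>D = 1\<close> the admissible length 0 forces the empty word. With a second
  word present, prefix-freeness rules the empty word out.\<close>

lemma ex_uniquely_decodable:
  assumes len: "len \<in> length_sequences D"
  shows "\<exists>\<omega> :: nat \<Rightarrow> bool list. (\<forall>i\<in>{1..D}. length (\<omega> i) = len i) \<and> (D \<ge> 2 \<longrightarrow> uniquely_decodable D \<omega>)"
proof -
  obtain \<omega> :: "nat \<Rightarrow> bool list" where \<omega>: "\<forall>i\<in>{1..D}. length (\<omega> i) = len i" "prefix_free {1..D} \<omega>"
    using kraft_converse[of D len] len unfolding length_sequences_def by blast
  have "uniquely_decodable D \<omega>" if two: "D \<ge> 2"
  proof (rule prefix_free_uniquely_decodable[OF \<omega>(2)])
    fix i assume i: "i \<in> {1..D}"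
    obtain j where j: "j \<in> {1..D}" "j \<noteq> i"
    proof
      show "(if i = 1 then 2 else 1) \<in> {1..D}" "(if i = 1 then 2 else 1) \<noteq> i"
        using two by auto
    qed
    show "\<omega> i \<noteq> []"
    proof
      assume "\<omega> i = []"
      then have "\<omega> i @ \<omega> j = \<omega> j" by simp
      then show False using prefix_freeD[OF \<omega>(2) i j(1)] j(2) by simp
    qed
  qed
  then show ?thesis using \<omega>(1) by blast
qed

theorem theorem3p1:
  fixes M :: "'w measure" and X :: "nat \<Rightarrow> 'w \<Rightarrow> nat"
    and s :: "nat \<Rightarrow> complex ^ 'd::finite" and N m l D :: nat
    and p :: "nat list \<Rightarrow> real"
    and lam :: "nat \<Rightarrow> nat \<Rightarrow> real" and e :: "nat \<Rightarrow> nat \<Rightarrow> 'd list vect"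
    and F :: "(nat \<Rightarrow> nat) \<Rightarrow> real"
  assumes source: "quantum_stochastic_source M X N s"
    and p: "p = mass_function M X"
    and m: "m \<ge> 1" and l: "l \<ge> 1"
    and D: "D = CARD('d) ^ l"
    and eigenbasis: "\<And>k. k \<in> {1..m} \<Longrightarrow> orthonormal_basis (tensor_power l) {1..D} (e k)"
    and eigenvalues: "\<And>k i. k \<in> {1..m} \<Longrightarrow> i \<in> {1..D} \<Longrightarrow>
          block_ensemble_state p N s l k (e k i) = (\<lambda>w. complex_of_real (lam k i) * e k i w)"
    and decreasing: "\<And>k. k \<in> {1..m} \<Longrightarrow> antimono_on {1..D} (lam k)"
    and F: "F = length_functional lam m D"
  shows
    "(\<exists>len. is_arg_min F (\<lambda>len. len \<in> length_sequences D) len) \<and>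
     (\<forall>len. is_arg_min F (\<lambda>len. len \<in> length_sequences D) len \<longrightarrow> ILC p N s m l = F len) \<and>
     (\<exists>V :: nat \<Rightarrow> 'd list vect \<Rightarrow> fock.
        is_arg_min (average_length p N s m l) (constrained_special_block_code m l) V \<and>
        average_length p N s m l V = ILC p N s m l) \<and>
     (\<forall>len. is_arg_min F (\<lambda>len. len \<in> length_sequences D) len \<longrightarrow>
        (\<exists>\<omega> :: nat \<Rightarrow> bool list. (\<forall>i\<in>{1..D}. length (\<omega> i) = len i) \<and>
            (CARD('d) \<ge> 2 \<longrightarrow> uniquely_decodable D \<omega>)) \<and>
        (\<forall>\<omega> :: nat \<Rightarrow> bool list. (\<forall>i\<in>{1..D}. length (\<omega> i) = len i) \<and>
            (CARD('d) \<ge> 2 \<longrightarrow> uniquely_decodable D \<omega>) \<longrightarrow>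
          jointly_orthonormal D (\<lambda>i. ket (\<omega> i)) \<and>
          (\<forall>i\<in>{1..D}. length_codeword (ket (\<omega> i))) \<and>
          constrained_special_block_code m l (\<lambda>k. code_map D (\<lambda>i. ket (\<omega> i)) (e k)) \<and>
          average_length p N s m l (\<lambda>k. code_map D (\<lambda>i. ket (\<omega> i)) (e k)) = F len))"
proof -
  let ?min = "is_arg_min F (\<lambda>len. len \<in> length_sequences D)"
  let ?L = "average_length p N s m l"
  let ?V = "\<lambda>(\<omega> :: nat \<Rightarrow> bool list) k. code_map D (\<lambda>i. ket (\<omega> i)) (e k)"
  let ?good = "\<lambda>len (\<omega> :: nat \<Rightarrow> bool list). (\<forall>i\<in>{1..D}. length (\<omega> i) = len i) \<and>
            (CARD('d) \<ge> 2 \<longrightarrow> uniquely_decodable D \<omega>)"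
  have D1: "D = 1" if "\<not> CARD('d) \<ge> 2"
  proof -
    have "CARD('d) = 1" using that zero_less_card_finite[where 'a = 'd] by linarith
    then show ?thesis by (simp add: D)
  qed
  have D2: "D \<ge> 2" if "CARD('d) \<ge> 2"
    using power_increasing[OF l, of "CARD('d)"] that by (simp add: D)
  have weight: "block_weight p N s l k (e k i) = lam k i" if "k \<in> {1..m}" "i \<in> {1..D}" for k i
    using that by (intro block_weight_eigenvector[OF _ eigenbasis _ eigenvalues]) auto
  \<comment> \<open>Positivity of the ensemble state: each eigenvalue is a sum of squared moduli
    with nonnegative weights.\<close>
  have lam: "lam k i \<ge> 0" if "k \<in> {1..m}" "i \<in> {1..D}" for k i
    unfolding weight[OF that, symmetric] block_weight_def p mass_function_def
    by (intro sum_nonneg mult_nonneg_nonneg) auto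
  \<comment> \<open>Sharing the lengths among blocks collapses \<open>F\<close> to one weighted sum,
    with the eigenvalues summed over \<open>k\<close> as weights.\<close>
  have F': "F len = (\<Sum>i=1..D. (\<Sum>k=1..m. lam k i) * real (len i))" for len
    unfolding F length_functional_def by (subst sum.swap) (simp add: sum_distrib_right)
  have ex_min: "\<exists>len. ?min len"
  proof -
    have "\<exists>len\<in>length_sequences D. \<forall>len'\<in>length_sequences D. F len \<le> F len'"
      unfolding F' using length_sequences_nonempty
      by (intro weighted_sum_attains_min sum_nonneg lam) auto
    then show ?thesis
      unfolding is_arg_min_linorder by blast
  qed
  have lower: "\<exists>len\<in>length_sequences D. F len \<le> ?L U"
    if code: "constrained_special_block_code m l U" for U :: "nat \<Rightarrow> 'd list vect \<Rightarrow> fock"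
  proof -
    obtain \<psi> e' where jo: "jointly_orthonormal D \<psi>"
      and cw: "\<forall>i\<in>{1..D}. length_codeword (\<psi> i)"
      and e'U: "\<forall>k\<in>{1..m}. orthonormal_basis (tensor_power l) {1..D} (e' k) \<and>
        (\<forall>v\<in>tensor_power l. U k v = code_map D \<psi> (e' k) v)"
      using code unfolding constrained_special_block_code_def D[symmetric] by blast
    have e': "orthonormal_basis (tensor_power l) {1..D} (e' k)" if "k \<in> {1..m}" for k
      using e'U that by blast
    have U: "U k v = code_map D \<psi> (e' k) v" if "k \<in> {1..m}" "v \<in> tensor_power l" for k v
      using e'U that by blast
    obtain len where len: "\<And>i. i \<in> {1..D} \<Longrightarrow> \<psi> i \<in> tensor_power (len i)"
      using cw unfolding length_codeword_def by metis
    obtain \<sigma> where \<sigma>: "bij_betw \<sigma> {1..D} {1..D}" "mono_on {1..D} (len \<circ> \<sigma>)"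
      using sorting_bijection[of D len] by blast
    \<comment> \<open>Reordering preserves the Kraft sum, so the sorted lengths are
      admissible.\<close>
    have "(\<Sum>i=1..D. 1 / 2 ^ len (\<sigma> i)) = (\<Sum>i=1..D. 1 / 2 ^ len i :: real)"
      by (rule sum.reindex_bij_betw[OF \<sigma>(1), of "\<lambda>i. 1 / 2 ^ len i"])
    then have "len \<circ> \<sigma> \<in> length_sequences D"
      using quantum_kraft_mcmillan[OF jo len] \<sigma>(2) by (simp add: length_sequences_def)
    moreover have "F (len \<circ> \<sigma>) \<le> (\<Sum>k=1..m. \<Sum>i=1..D. block_weight p N s l k (e' k i) * real (len i))"
      unfolding F length_functional_def comp_def
      by (intro sum_mono block_weight_lower_bound[OF _ eigenbasis eigenvalues decreasing e' \<sigma>]) auto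
    ultimately show ?thesis
      using average_length_code[OF source p m jo len e' U] by auto
  qed
  have ex_good: "\<exists>\<omega>. ?good len \<omega>" if "?min len" for len
    using ex_uniquely_decodable[of len D] D2 that by (auto simp: is_arg_min_def)
  have good: "jointly_orthonormal D (\<lambda>i. ket (\<omega> i))" "constrained_special_block_code m l (?V \<omega>)"
    "?L (?V \<omega>) = F len" if \<omega>: "?good len \<omega>" for len \<omega>
  proof -
    have ud: "D = 1 \<or> uniquely_decodable D \<omega>" using D1 \<omega> by blast
    show jo: "jointly_orthonormal D (\<lambda>i. ket (\<omega> i))"
      by (rule kets_jointly_orthonormal) (rule concat_inj_on_tuples[OF ud])
    show "constrained_special_block_code m l (?V \<omega>)"
      by (rule ket_code[OF D ud eigenbasis])
    have "ket (\<omega> i) \<in> tensor_power (len i)" if "i \<in> {1..D}" for i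
      using ket_in_tensor_power[of "\<omega> i"] \<omega> that by simp
    then have "?L (?V \<omega>) = (\<Sum>k=1..m. \<Sum>i=1..D. block_weight p N s l k (e k i) * real (len i))"
      by (intro average_length_code[OF source p m jo _ eigenbasis]) auto
    then show "?L (?V \<omega>) = F len"
      by (simp add: F length_functional_def weight)
  qed
  have optimal: "is_arg_min ?L (constrained_special_block_code m l) (?V \<omega>)" "ILC p N s m l = F len"
    if len: "?min len" and \<omega>: "?good len \<omega>" for len \<omega>
  proof -
    \<comment> \<open>Every code costs at least the value of some admissible sequence, hence at
      least the minimum; the code on the eigenbases attains it.\<close>
    have le: "F len \<le> ?L U" if "constrained_special_block_code m l U" for U :: "nat \<Rightarrow> 'd list vect \<Rightarrow> fock"
      using lower[OF that] len by (force simp: is_arg_min_linorder)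
    then show "is_arg_min ?L (constrained_special_block_code m l) (?V \<omega>)"
      using good[OF \<omega>] by (simp add: is_arg_min_linorder)
    show "ILC p N s m l = F len"
      unfolding ILC_def
    proof (rule cInf_eq_minimum)
      show "F len \<in> {?L U |U. constrained_special_block_code m l U}"
        using good(2)[OF \<omega>] unfolding good(3)[OF \<omega>, symmetric] by blast
    qed (use le in blast)
  qed
  have "ILC p N s m l = F len" if "?min len" for len
    using optimal(2)[OF that] ex_good[OF that] by blast
  moreover have "\<exists>V. is_arg_min ?L (constrained_special_block_code m l) V \<and> ?L V = ILC p N s m l"
  proof -
    obtain len \<omega> where *: "?min len" "?good len \<omega>" using ex_min ex_good by blast
    then show ?thesis using optimal[OF *] good(3)[OF *(2)] by metis
  qed
  ultimately show ?thesis
    using ex_min ex_good good ket_length_codeword by blast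
qed

end
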